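(* Let $1<p<\infty$, and let $(\Omega,d,\mu)$ be a bounded, locally compact, non-complete metric measure space such that $\Omega$ is a uniform domain in its completion, $\mu$ is doubling, and $(\Omega,d,\mu)$ supports a $p$-Poincaré inequality. Let $\partial\Omega=\overline\Omega\setminus\Omega$ carry a Borel regular measure $\nu$ that is $\Theta$-codimensional to $\mu$ for some $0<\Theta<p$, and put $\theta=1-\Theta/p$. For $f\in HB^\theta_{p,p}(\partial\Omega)$ let $u_f\in HN^{1,p}(\Omega)$ be the solution to the Dirichlet problem with boundary data $f$, and let $L_f(g)=\int_\Omega|\nabla u_f|^{p-2}\langle\nabla u_f,\nabla Eg\rangle\,d\mu$ for $g\in HB^\theta_{p,p}(\partial\Omega)$. Then the (Dirichlet-to-Neumann) map $$\mathrm{DtN}:HB^\theta_{p,p}(\partial\Omega)\to(HB^\theta_{p,p}(\partial\Omega))^*,\qquad \mathrm{DtN}(f)=L_f,$$ is well defined and bounded, with $$\|\mathrm{DtN}\|:=\sup_{\|f\|_{HB^\theta_{p,p}(\partial\Omega)}=1}\|L_f\|\le\|E\|^p.$$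
   Context: **Domain.** $\overline\Omega$ is the completion of $\Omega$ and $\partial\Omega=\overline\Omega\setminus\Omega$. $\Omega$ is a uniform domain if there is $C\ge1$ such that every pair $x\ne y$ in $\Omega$ is joined by a curve $\gamma$ in $\Omega$ with length $\ell(\gamma)\le C\,d(x,y)$ and, for every $z$ on $\gamma$ and subcurves $\gamma_{x,z},\gamma_{z,y}$ of $\gamma$ from $x$ to $z$ and from $z$ to $y$, $\min\{\ell(\gamma_{x,z}),\ell(\gamma_{z,y})\}\le C\,\mathrm{dist}(z,\partial\Omega)$. $\mu$ is a Borel regular measure with $0<\mu(B)<\infty$ for all balls $B$; it is doubling if $\mu(2B)\le C\mu(B)$ for all balls. **Upper gradients, Poincaré.** A Borel $g:\Omega\to[0,\infty]$ is an upper gradient of $u:\Omega\to\mathbb R$ if $|u(y)-u(x)|\le\int_\gamma g\,ds$ for every non-constant compact rectifiable curve $\gamma$ joining $x,y$; it is a $p$-weak upper gradient if this holds for all such curves except a family $\Gamma$ for which there is a nonnegative Borel $\rho\in L^p(\Omega)$ with $\int_\gamma\rho\,ds=\infty$ for all $\gamma\in\Gamma$. The $p$-Poincaré inequality: there are $C>0,\lambda\ge1$ with $\frac1{\mu(B)}\int_B|u-u_B|\,d\mu\le C\,\mathrm{rad}(B)\big(\frac1{\mu(\lambda B)}\int_{\lambda B}g^p\,d\mu\big)^{1/p}$ for all balls $B$, all $u$ and all upper gradients $g$ of $u$, where $u_B=\frac1{\mu(B)}\int_Bu\,d\mu$. **Codimension.** $\nu$ is $\Theta$-codimensional to $\mu$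 if there is $C>0$ with $C^{-1}\mu(B(x,r)\cap\Omega)r^{-\Theta}\le\nu(B(x,r)\cap\partial\Omega)\le C\mu(B(x,r)\cap\Omega)r^{-\Theta}$ for all $x\in\partial\Omega$, $0<r<2\,\mathrm{diam}(\partial\Omega)$. Balls are balls of $\overline\Omega$; $\nu$ is regarded as a measure on $\overline\Omega$ supported on $\partial\Omega$. **Sobolev spaces.** $N^{1,p}(\Omega)$ is the space of functions in $L^p(\Omega)$ having a $p$-weak upper gradient in $L^p(\Omega)$, normed by $\|u\|_{L^p}+\inf_g\|g\|_{L^p}$ (infimum over $p$-weak upper gradients $g$ of $u$), modulo functions of norm zero. $HN^{1,p}(\Omega)$ is the quotient of $N^{1,p}(\Omega)$ by constant functions, with norm $\inf_g\|g\|_{L^p(\Omega)}$. **Cheeger gradient.** Fix a Cheeger differential structure on $\Omega$ of some dimension $N$: countably many measurable coordinate patches $\Omega_\alpha$ of positive measure covering $\mu$-almost all of $\Omega$, Lipschitz maps $\varphi_\alpha:\Omega_\alpha\to\mathbb R^N$, and measurable inner products $\langle\cdot,\cdot\rangle_x$ on $\mathbb R^N$, so that each $u\in N^{1,p}(\Omega)$ has, for $\mu$-a.e. $x\in\Omega_\alpha$, a vector $\nabla u(x)\in\mathbb R^N$ with $\operatorname{ess\,lim\,sup}_{\Omega_\alpha\ni y\to x}|u(y)-u(x)-\langle\nabla u(x),\varphi_\alpha(y)-\varphi_\alpha(x)\rangle_x|/d(x,y)=0$. The map $u\mapsto\nabla u$ is linear, and the structure is chosen so that $|\nabla u(x)|=\langle\nabla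 u(x),\nabla u(x)\rangle_x^{1/2}$ is comparable, with uniform constants, $\mu$-a.e. to the minimal $p$-weak upper gradient of $u$. $\nabla u$ is well defined for $u\in HN^{1,p}(\Omega)$. The subscript $x$ on the inner product is suppressed, and $|\nabla u|^{p-2}\nabla u$ is read as $0$ where $\nabla u=0$. **Besov space.** $\dot B^\theta_{p,p}(\partial\Omega)$ is the set of measurable $f$ on $\partial\Omega$ with $$\|f\|^p_{HB^\theta_{p,p}(\partial\Omega)}=\int_{\partial\Omega}\int_{\partial\Omega}\frac{|f(y)-f(x)|^p}{d(y,x)^{\theta p}\,\nu(B(y,d(y,x)))}\,d\nu(x)\,d\nu(y)<\infty,$$ and $HB^\theta_{p,p}(\partial\Omega)=\dot B^\theta_{p,p}(\partial\Omega)/\mathbb R$ (modulo constants), with this norm. $(HB^\theta_{p,p}(\partial\Omega))^*$ is its dual (bounded linear functionals), with dual norm $\|L\|=\sup\{|L(g)|:\|g\|_{HB^\theta_{p,p}(\partial\Omega)}\le1\}$. **Trace and extension (known result of Malý).** When $1<p<\infty$, $\Omega$ is a bounded, locally compact, non-complete metric space that is a uniform domain in its completion, $\mu$ is doubling, $(\Omega,d,\mu)$ supports a $p$-Poincaré inequality, $\nu$ is a Borel regular measure on $\partial\Omega$ that is $\Theta$-codimensional to $\mu$ with $0<\Theta<p$, and $\theta=1-\Theta/p$, there is a surjective bounded linear trace operator $\mathrm{Tr}:N^{1,p}(\Omega)\to\dot B^\theta_{p,p}(\partial\Omega)$, where $\mathrm{Tr}(u)(\xi)$ is characterized for $\nu$-a.e.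 $\xi$ by $\lim_{r\to0^+}\frac1{\mu(B(\xi,r))}\int_{B(\xi,r)}|u-\mathrm{Tr}(u)(\xi)|\,d\mu=0$, and a bounded linear extension operator $E:\dot B^\theta_{p,p}(\partial\Omega)\to N^{1,p}(\Omega)$ with $\mathrm{Tr}\circ E$ the identity. They induce bounded linear operators $\mathrm{Tr}:HN^{1,p}(\Omega)\to HB^\theta_{p,p}(\partial\Omega)$ and $E:HB^\theta_{p,p}(\partial\Omega)\to HN^{1,p}(\Omega)$ with $\mathrm{Tr}\circ E=\mathrm{id}$, used here. $\|\mathrm{Tr}\|$ and $\|E\|$ denote their operator norms with respect to the Cheeger energy: $\|\mathrm{Tr}(u)\|_{HB^\theta_{p,p}(\partial\Omega)}\le\|\mathrm{Tr}\|\,\|\nabla u\|_{L^p(\Omega)}$ and $\|\nabla Ef\|_{L^p(\Omega)}\le\|E\|\,\|f\|_{HB^\theta_{p,p}(\partial\Omega)}$. **Dirichlet problem.** $N^{1,p}_0(\Omega)$ is the set of $v\in N^{1,p}(\Omega)$ with $\mathrm{Tr}(v)=0$ $\nu$-a.e. For $\tilde f\in\dot B^\theta_{p,p}(\partial\Omega)$, the solution to the Dirichlet problem is the function $u\in N^{1,p}(\Omega)$ with $\mathrm{Tr}(u)=\tilde f$ $\nu$-a.e. and $\int_\Omega|\nabla u|^p\,d\mu\le\int_\Omega|\nabla(u+v)|^p\,d\mu$ for all $v\in N^{1,p}_0(\Omega)$ (it is known to exist). For $f\in HB^\theta_{p,p}(\partial\Omega)$, the solution $u_f\in HN^{1,p}(\Omega)$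 is the class consisting of the solutions for all representatives $\tilde f$ of $f$ (these differ by constants). *)

theory Defs
  imports "HOL-Analysis.Analysis"
begin

text \<open>
  The domain is a subset \<open>\<Omega>\<close> of an ambient metric space whose closure is complete, so that
  \<open>closure \<Omega>\<close> is the completion of \<open>\<Omega>\<close> and \<open>closure \<Omega> - \<Omega>\<close> its boundary; every completion arises
  this way. A measure on \<open>\<Omega>\<close> (on the boundary) is a measure \<open>M\<close> with \<open>space M = \<Omega>\<close>
  (\<open>space M = closure \<Omega> - \<Omega>\<close>), so a ball meets the space in question as \<open>ball x r \<inter> space M\<close>.
  Elements of function spaces are functions on the ambient type; values outside the relevant
  space play no role.
\<close>

text \<open>Only used for exponents \<open>a > 0\<close>.\<close>

definition enn_powr :: "ennreal \<Rightarrow> real \<Rightarrow> ennreal" where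
  "enn_powr x a = (if x = \<infinity> then \<infinity> else ennreal (enn2real x powr a))"

definition enn_Lp_norm :: "real \<Rightarrow> 'a measure \<Rightarrow> ('a \<Rightarrow> ennreal) \<Rightarrow> ennreal" where
  "enn_Lp_norm p M g = enn_powr (\<integral>\<^sup>+x. enn_powr (g x) p \<partial>M) (1 / p)"

definition curve_length :: "(real \<Rightarrow> 'a::metric_space) \<Rightarrow> real \<Rightarrow> real \<Rightarrow> ennreal" where
  "curve_length \<gamma> a b =
     (SUP (t, n) \<in> {t :: nat \<Rightarrow> real. mono t \<and> range t \<subseteq> {a..b}} \<times> (UNIV :: nat set).
        \<Sum>i<n. ennreal (dist (\<gamma> (t i)) (\<gamma> (t (Suc i)))))"

definition rectifiable_curve :: "'a::metric_space set \<Rightarrow> (real \<Rightarrow> 'a) \<Rightarrow> bool" where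
  "rectifiable_curve \<Omega> \<gamma> \<longleftrightarrow>
     path \<gamma> \<and> path_image \<gamma> \<subseteq> \<Omega> \<and> curve_length \<gamma> 0 1 < \<infinity> \<and> \<not> \<gamma> constant_on {0..1}"

text \<open>
  The point of \<open>\<gamma>\<close> at arc length \<open>s\<close> from the start; \<open>\<gamma>\<close> is constant on the set of all admissible
  \<open>t\<close>, so the choice is immaterial.
\<close>

definition arclength_param :: "(real \<Rightarrow> 'a::metric_space) \<Rightarrow> real \<Rightarrow> 'a" where
  "arclength_param \<gamma> s = \<gamma> (SOME t. t \<in> {0..1} \<and> curve_length \<gamma> 0 t = ennreal s)"

definition curve_integral :: "(real \<Rightarrow> 'a::metric_space) \<Rightarrow> ('a \<Rightarrow> ennreal) \<Rightarrow> ennreal" where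
  "curve_integral \<gamma> g =
     (\<integral>\<^sup>+s\<in>{0..enn2real (curve_length \<gamma> 0 1)}. g (arclength_param \<gamma> s) \<partial>lborel)"

definition uniform_domain :: "'a::metric_space set \<Rightarrow> bool" where
  "uniform_domain \<Omega> \<longleftrightarrow>
     (\<exists>C\<ge>1. \<forall>x\<in>\<Omega>. \<forall>y\<in>\<Omega>. x \<noteq> y \<longrightarrow>
       (\<exists>\<gamma>. path \<gamma> \<and> path_image \<gamma> \<subseteq> \<Omega> \<and> pathstart \<gamma> = x \<and> pathfinish \<gamma> = y \<and>
            curve_length \<gamma> 0 1 \<le> ennreal (C * dist x y) \<and>
            (\<forall>t\<in>{0..1}. min (curve_length \<gamma> 0 t) (curve_length \<gamma> t 1)
                          \<le> ennreal (C * infdist (\<gamma> t) (closure \<Omega> - \<Omega>)))))"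

text \<open>
  The \<open>\<sigma>\<close>-algebra may be larger than the Borel one, so both a Borel measure and its completion
  (the measurable sets of a Borel regular outer measure) are covered.
\<close>

definition borel_regular :: "'a::metric_space set \<Rightarrow> 'a measure \<Rightarrow> bool" where
  "borel_regular S M \<longleftrightarrow>
     space M = S \<and> sets (restrict_space borel S) \<subseteq> sets M \<and>
     (\<forall>A\<in>sets M. \<exists>B\<in>sets (restrict_space borel S). A \<subseteq> B \<and> emeasure M B = emeasure M A)"

definition positive_finite_on_balls :: "'a::metric_space measure \<Rightarrow> bool" where
  "positive_finite_on_balls M \<longleftrightarrow>
     (\<forall>x\<in>space M. \<forall>r>0. 0 < emeasure M (ball x r \<inter> space M) \<and> emeasure M (ball x r \<inter> space M) < \<infinity>)"

definition doubling_measure :: "'a::metric_space measure \<Rightarrow> bool" where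
  "doubling_measure M \<longleftrightarrow>
     (\<exists>C>0. \<forall>x\<in>space M. \<forall>r>0.
        emeasure M (ball x (2 * r) \<inter> space M) \<le> ennreal C * emeasure M (ball x r \<inter> space M))"

definition codimensional :: "real \<Rightarrow> 'a::metric_space measure \<Rightarrow> 'a measure \<Rightarrow> bool" where
  "codimensional \<Theta> \<mu> \<nu> \<longleftrightarrow>
     (\<exists>C>0. \<forall>x\<in>space \<nu>. \<forall>r. 0 < r \<and> r < 2 * diameter (space \<nu>) \<longrightarrow>
        ennreal (r powr (- \<Theta>) / C) * emeasure \<mu> (ball x r \<inter> space \<mu>)
          \<le> emeasure \<nu> (ball x r \<inter> space \<nu>) \<and>
        emeasure \<nu> (ball x r \<inter> space \<nu>)
          \<le> ennreal (C * r powr (- \<Theta>)) * emeasure \<mu> (ball x r \<inter> space \<mu>))"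

definition upper_gradient :: "'a::metric_space set \<Rightarrow> ('a \<Rightarrow> real) \<Rightarrow> ('a \<Rightarrow> ennreal) \<Rightarrow> bool" where
  "upper_gradient \<Omega> u g \<longleftrightarrow>
     g \<in> borel_measurable (restrict_space borel \<Omega>) \<and>
     (\<forall>\<gamma>. rectifiable_curve \<Omega> \<gamma> \<longrightarrow>
        ennreal \<bar>u (pathfinish \<gamma>) - u (pathstart \<gamma>)\<bar> \<le> curve_integral \<gamma> g)"

definition exceptional_family :: "real \<Rightarrow> 'a::metric_space measure \<Rightarrow> (real \<Rightarrow> 'a) set \<Rightarrow> bool" where
  "exceptional_family p M \<Gamma> \<longleftrightarrow>
     (\<exists>\<rho>. \<rho> \<in> borel_measurable (restrict_space borel (space M)) \<and> enn_Lp_norm p M \<rho> < \<infinity> \<and>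
          (\<forall>\<gamma>\<in>\<Gamma>. curve_integral \<gamma> \<rho> = \<infinity>))"

definition weak_upper_gradient ::
    "real \<Rightarrow> 'a::metric_space measure \<Rightarrow> ('a \<Rightarrow> real) \<Rightarrow> ('a \<Rightarrow> ennreal) \<Rightarrow> bool" where
  "weak_upper_gradient p M u g \<longleftrightarrow>
     g \<in> borel_measurable (restrict_space borel (space M)) \<and>
     (\<exists>\<Gamma>. exceptional_family p M \<Gamma> \<and>
        (\<forall>\<gamma>. rectifiable_curve (space M) \<gamma> \<and> \<gamma> \<notin> \<Gamma> \<longrightarrow>
           ennreal \<bar>u (pathfinish \<gamma>) - u (pathstart \<gamma>)\<bar> \<le> curve_integral \<gamma> g))"

definition minimal_weak_upper_gradient ::
    "real \<Rightarrow> 'a::metric_space measure \<Rightarrow> ('a \<Rightarrow> real) \<Rightarrow> ('a \<Rightarrow> ennreal) \<Rightarrow> bool" where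
  "minimal_weak_upper_gradient p M u g \<longleftrightarrow>
     weak_upper_gradient p M u g \<and> enn_Lp_norm p M g < \<infinity> \<and>
     (\<forall>h. weak_upper_gradient p M u h \<and> enn_Lp_norm p M h < \<infinity> \<longrightarrow> (AE x in M. g x \<le> h x))"

text \<open>The inequality is required of those \<open>u\<close> for which the mean value \<open>u\<^sub>B\<close> is defined.\<close>

definition poincare_inequality :: "real \<Rightarrow> 'a::metric_space measure \<Rightarrow> bool" where
  "poincare_inequality p M \<longleftrightarrow>
     (\<exists>C>0. \<exists>\<Lambda>\<ge>1. \<forall>x\<in>space M. \<forall>r>0. \<forall>u g.
        let B = ball x r \<inter> space M; B' = ball x (\<Lambda> * r) \<inter> space M;
            u\<^sub>B = (LINT y:B|M. u y) / measure M B
        in u \<in> borel_measurable M \<and> set_integrable M B u \<and> upper_gradient (space M) u g \<longrightarrow>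
           (\<integral>\<^sup>+y\<in>B. ennreal \<bar>u y - u\<^sub>B\<bar> \<partial>M) / emeasure M B
             \<le> ennreal (C * r) *
               enn_powr ((\<integral>\<^sup>+y\<in>B'. enn_powr (g y) p \<partial>M) / emeasure M B') (1 / p))"

definition newton_norm :: "real \<Rightarrow> 'a::metric_space measure \<Rightarrow> ('a \<Rightarrow> real) \<Rightarrow> ennreal" where
  "newton_norm p M u =
     enn_Lp_norm p M (\<lambda>x. ennreal \<bar>u x\<bar>) + (INF g\<in>Collect (weak_upper_gradient p M u). enn_Lp_norm p M g)"

definition newton_space :: "real \<Rightarrow> 'a::metric_space measure \<Rightarrow> ('a \<Rightarrow> real) set" where
  "newton_space p M =
     {u \<in> borel_measurable M. enn_Lp_norm p M (\<lambda>x. ennreal \<bar>u x\<bar>) < \<infinity> \<and>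
        (\<exists>g. weak_upper_gradient p M u g \<and> enn_Lp_norm p M g < \<infinity>)}"

text \<open>
  Elements of the homogeneous space \<open>HN\<close> are classes of functions, modulo constants and modulo
  functions of Newtonian norm zero.
\<close>

definition hn_class :: "real \<Rightarrow> 'a::metric_space measure \<Rightarrow> ('a \<Rightarrow> real) \<Rightarrow> ('a \<Rightarrow> real) set" where
  "hn_class p M u = {v \<in> newton_space p M. \<exists>c. newton_norm p M (\<lambda>x. v x - (u x + c)) = 0}"

definition hn_space :: "real \<Rightarrow> 'a::metric_space measure \<Rightarrow> ('a \<Rightarrow> real) set set" where
  "hn_space p M = hn_class p M ` newton_space p M"

record ('a, 'n::finite) cheeger =
  patch_index :: "nat set"
  patch :: "nat \<Rightarrow> 'a set"
  chart :: "nat \<Rightarrow> 'a \<Rightarrow> real ^ 'n"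
  iprod :: "'a \<Rightarrow> real ^ 'n \<Rightarrow> real ^ 'n \<Rightarrow> real"
  grad :: "('a \<Rightarrow> real) \<Rightarrow> 'a \<Rightarrow> real ^ 'n"

definition is_inner_product :: "(real ^ 'n::finite \<Rightarrow> real ^ 'n \<Rightarrow> real) \<Rightarrow> bool" where
  "is_inner_product b \<longleftrightarrow>
     bilinear b \<and> (\<forall>v w. b v w = b w v) \<and> (\<forall>v. v \<noteq> 0 \<longrightarrow> 0 < b v v)"

definition grad_norm :: "('a, 'n::finite) cheeger \<Rightarrow> ('a \<Rightarrow> real) \<Rightarrow> 'a \<Rightarrow> real" where
  "grad_norm S u x = sqrt (iprod S x (grad S u x) (grad S u x))"

text \<open>
  The filter \<open>inf (at x within A) (ae_filter M)\<close> consists of the sets containing almost all of a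
  punctured neighbourhood of \<open>x\<close> in \<open>A\<close>, so \<open>Limsup\<close> along it is the essential upper limit.
\<close>

definition cheeger_structure ::
    "real \<Rightarrow> 'a::metric_space measure \<Rightarrow> ('a, 'n::finite) cheeger \<Rightarrow> bool" where
  "cheeger_structure p M S \<longleftrightarrow>
     (\<forall>\<alpha>\<in>patch_index S. patch S \<alpha> \<in> sets M \<and> 0 < emeasure M (patch S \<alpha>) \<and>
        (\<exists>L. L-lipschitz_on (patch S \<alpha>) (chart S \<alpha>))) \<and>
     (AE x in M. x \<in> (\<Union>\<alpha>\<in>patch_index S. patch S \<alpha>)) \<and>
     (\<forall>x\<in>space M. is_inner_product (iprod S x)) \<and>
     (\<forall>v w. (\<lambda>x. iprod S x v w) \<in> borel_measurable M) \<and>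
     (\<forall>u\<in>newton_space p M. grad S u \<in> borel_measurable M \<and>
        (\<forall>\<alpha>\<in>patch_index S. AE x in M. x \<in> patch S \<alpha> \<longrightarrow>
           Limsup (inf (at x within patch S \<alpha>) (ae_filter M))
             (\<lambda>y. ereal (\<bar>u y - u x - iprod S x (grad S u x) (chart S \<alpha> y - chart S \<alpha> x)\<bar>
                         / dist x y)) = 0)) \<and>
     (\<forall>u\<in>newton_space p M. \<forall>v\<in>newton_space p M. \<forall>a b.
        AE x in M. grad S (\<lambda>y. a * u y + b * v y) x = a *\<^sub>R grad S u x + b *\<^sub>R grad S v x) \<and>
     (\<exists>K\<ge>1. \<forall>u\<in>newton_space p M. \<exists>g. minimal_weak_upper_gradient p M u g \<and>
        (AE x in M. g x \<le> ennreal (K * grad_norm S u x) \<and>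
                    ennreal (grad_norm S u x) \<le> ennreal K * g x))"

definition cheeger_energy ::
    "real \<Rightarrow> 'a measure \<Rightarrow> ('a, 'n::finite) cheeger \<Rightarrow> ('a \<Rightarrow> real) \<Rightarrow> ennreal" where
  "cheeger_energy p M S u = (\<integral>\<^sup>+x. ennreal (grad_norm S u x powr p) \<partial>M)"

text \<open>
  The integrand \<open>\<bar>\<nabla>u\<bar>\<^bsup>p-2\<^esup>\<langle>\<nabla>u, \<nabla>w\<rangle>\<close>; since \<open>0 powr a = 0\<close> for every \<open>a\<close>, it vanishes where
  \<open>\<nabla>u = 0\<close>, also for \<open>p < 2\<close>.
\<close>

definition flux_density ::
    "real \<Rightarrow> ('a, 'n::finite) cheeger \<Rightarrow> ('a \<Rightarrow> real) \<Rightarrow> ('a \<Rightarrow> real) \<Rightarrow> 'a \<Rightarrow> real" where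
  "flux_density p S u w x = grad_norm S u x powr (p - 2) * iprod S x (grad S u x) (grad S w x)"

text \<open>On the diagonal the integrand is \<open>0 / 0 = 0\<close>.\<close>

definition besov_norm :: "real \<Rightarrow> real \<Rightarrow> 'a::metric_space measure \<Rightarrow> ('a \<Rightarrow> real) \<Rightarrow> ennreal" where
  "besov_norm p \<theta> \<nu> f =
     enn_powr
       (\<integral>\<^sup>+y. (\<integral>\<^sup>+x. ennreal (\<bar>f y - f x\<bar> powr p)
                / (ennreal (dist y x powr (\<theta> * p)) * emeasure \<nu> (ball y (dist y x) \<inter> space \<nu>))
              \<partial>\<nu>) \<partial>\<nu>) (1 / p)"

definition besov_space :: "real \<Rightarrow> real \<Rightarrow> 'a::metric_space measure \<Rightarrow> ('a \<Rightarrow> real) set" where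
  "besov_space p \<theta> \<nu> = {f \<in> borel_measurable \<nu>. besov_norm p \<theta> \<nu> f < \<infinity>}"

definition hb_class ::
    "real \<Rightarrow> real \<Rightarrow> 'a::metric_space measure \<Rightarrow> ('a \<Rightarrow> real) \<Rightarrow> ('a \<Rightarrow> real) set" where
  "hb_class p \<theta> \<nu> f = {f' \<in> besov_space p \<theta> \<nu>. \<exists>c. AE x in \<nu>. f' x = f x + c}"

definition hb_space :: "real \<Rightarrow> real \<Rightarrow> 'a::metric_space measure \<Rightarrow> ('a \<Rightarrow> real) set set" where
  "hb_space p \<theta> \<nu> = hb_class p \<theta> \<nu> ` besov_space p \<theta> \<nu>"

definition hb_norm :: "real \<Rightarrow> real \<Rightarrow> 'a::metric_space measure \<Rightarrow> ('a \<Rightarrow> real) set \<Rightarrow> ennreal" where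
  "hb_norm p \<theta> \<nu> F = besov_norm p \<theta> \<nu> (SOME f. f \<in> F)"

definition hb_dual ::
    "real \<Rightarrow> real \<Rightarrow> 'a::metric_space measure \<Rightarrow> (('a \<Rightarrow> real) set \<Rightarrow> real) set" where
  "hb_dual p \<theta> \<nu> =
     {L. (\<forall>f\<in>besov_space p \<theta> \<nu>. \<forall>g\<in>besov_space p \<theta> \<nu>. \<forall>a b.
            L (hb_class p \<theta> \<nu> (\<lambda>x. a * f x + b * g x))
              = a * L (hb_class p \<theta> \<nu> f) + b * L (hb_class p \<theta> \<nu> g)) \<and>
         (\<exists>C\<ge>0. \<forall>G\<in>hb_space p \<theta> \<nu>. ennreal \<bar>L G\<bar> \<le> ennreal C * hb_norm p \<theta> \<nu> G)}"

definition hb_dual_norm ::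
    "real \<Rightarrow> real \<Rightarrow> 'a::metric_space measure \<Rightarrow> (('a \<Rightarrow> real) set \<Rightarrow> real) \<Rightarrow> ennreal" where
  "hb_dual_norm p \<theta> \<nu> L = (SUP G\<in>{G \<in> hb_space p \<theta> \<nu>. hb_norm p \<theta> \<nu> G \<le> 1}. ennreal \<bar>L G\<bar>)"

text \<open>\<open>has_trace \<mu> \<nu> u f\<close> reads: \<open>Tr u = f\<close> holds \<open>\<nu>\<close>-almost everywhere.\<close>

definition has_trace ::
    "'a::metric_space measure \<Rightarrow> 'a measure \<Rightarrow> ('a \<Rightarrow> real) \<Rightarrow> ('a \<Rightarrow> real) \<Rightarrow> bool" where
  "has_trace \<mu> \<nu> u f \<longleftrightarrow>
     (AE \<xi> in \<nu>.
        ((\<lambda>r. (\<integral>\<^sup>+x\<in>ball \<xi> r \<inter> space \<mu>. ennreal \<bar>u x - f \<xi>\<bar> \<partial>\<mu>) / emeasure \<mu> (ball \<xi> r \<inter> space \<mu>))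
          \<longlongrightarrow> 0) (at_right 0))"

definition extension_norm ::
    "real \<Rightarrow> real \<Rightarrow> 'a::metric_space measure \<Rightarrow> 'a measure \<Rightarrow> ('a, 'n::finite) cheeger \<Rightarrow>
     (('a \<Rightarrow> real) \<Rightarrow> 'a \<Rightarrow> real) \<Rightarrow> ennreal" where
  "extension_norm p \<theta> \<mu> \<nu> S E =
     (SUP f\<in>{f \<in> besov_space p \<theta> \<nu>. besov_norm p \<theta> \<nu> f \<le> 1}.
        enn_powr (cheeger_energy p \<mu> S (E f)) (1 / p))"

text \<open>
  Linearity is understood in the Newtonian space, that is, modulo functions of norm zero.
  Boundedness is that of the induced operator on the homogeneous spaces.
\<close>

definition extension_operator ::
    "real \<Rightarrow> real \<Rightarrow> 'a::metric_space measure \<Rightarrow> 'a measure \<Rightarrow> ('a, 'n::finite) cheeger \<Rightarrow>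
     (('a \<Rightarrow> real) \<Rightarrow> 'a \<Rightarrow> real) \<Rightarrow> bool" where
  "extension_operator p \<theta> \<mu> \<nu> S E \<longleftrightarrow>
     (\<forall>f\<in>besov_space p \<theta> \<nu>. E f \<in> newton_space p \<mu> \<and> has_trace \<mu> \<nu> (E f) f) \<and>
     (\<forall>f\<in>besov_space p \<theta> \<nu>. \<forall>g\<in>besov_space p \<theta> \<nu>. \<forall>a b.
        newton_norm p \<mu> (\<lambda>x. E (\<lambda>\<xi>. a * f \<xi> + b * g \<xi>) x - (a * E f x + b * E g x)) = 0) \<and>
     extension_norm p \<theta> \<mu> \<nu> S E < \<infinity>"

definition newton_space_0 ::
    "real \<Rightarrow> 'a::metric_space measure \<Rightarrow> 'a measure \<Rightarrow> ('a \<Rightarrow> real) set" where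
  "newton_space_0 p \<mu> \<nu> = {v \<in> newton_space p \<mu>. has_trace \<mu> \<nu> v (\<lambda>\<xi>. 0)}"

definition dirichlet_solution ::
    "real \<Rightarrow> 'a::metric_space measure \<Rightarrow> 'a measure \<Rightarrow> ('a, 'n::finite) cheeger \<Rightarrow>
     ('a \<Rightarrow> real) \<Rightarrow> ('a \<Rightarrow> real) \<Rightarrow> bool" where
  "dirichlet_solution p \<mu> \<nu> S f u \<longleftrightarrow>
     u \<in> newton_space p \<mu> \<and> has_trace \<mu> \<nu> u f \<and>
     (\<forall>v\<in>newton_space_0 p \<mu> \<nu>. cheeger_energy p \<mu> S u \<le> cheeger_energy p \<mu> S (\<lambda>x. u x + v x))"

definition dirichlet_class ::
    "real \<Rightarrow> 'a::metric_space measure \<Rightarrow> 'a measure \<Rightarrow> ('a, 'n::finite) cheeger \<Rightarrow>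
     ('a \<Rightarrow> real) set \<Rightarrow> ('a \<Rightarrow> real) set" where
  "dirichlet_class p \<mu> \<nu> S F = {u. \<exists>f\<in>F. dirichlet_solution p \<mu> \<nu> S f u}"

text \<open>
  For a boundary class \<open>F\<close>, \<open>DtN p \<mu> \<nu> S E F\<close> is the functional \<open>L\<^sub>F\<close>, evaluated on a class \<open>G\<close>
  through representatives of \<open>dirichlet_class p \<mu> \<nu> S F\<close> and of \<open>G\<close>.
\<close>

definition DtN ::
    "real \<Rightarrow> 'a::metric_space measure \<Rightarrow> 'a measure \<Rightarrow> ('a, 'n::finite) cheeger \<Rightarrow>
     (('a \<Rightarrow> real) \<Rightarrow> 'a \<Rightarrow> real) \<Rightarrow> ('a \<Rightarrow> real) set \<Rightarrow> ('a \<Rightarrow> real) set \<Rightarrow> real" where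
  "DtN p \<mu> \<nu> S E F G =
     (LINT x|\<mu>. flux_density p S (SOME u. u \<in> dirichlet_class p \<mu> \<nu> S F) (E (SOME g. g \<in> G)) x)"

definition DtN_norm ::
    "real \<Rightarrow> real \<Rightarrow> 'a::metric_space measure \<Rightarrow> 'a measure \<Rightarrow> ('a, 'n::finite) cheeger \<Rightarrow>
     (('a \<Rightarrow> real) \<Rightarrow> 'a \<Rightarrow> real) \<Rightarrow> ennreal" where
  "DtN_norm p \<theta> \<mu> \<nu> S E =
     (SUP F\<in>{F \<in> hb_space p \<theta> \<nu>. hb_norm p \<theta> \<nu> F = 1}. hb_dual_norm p \<theta> \<nu> (DtN p \<mu> \<nu> S E F))"

end

theory Submission
  imports Defs
begin

text \<open>
  Write \<open>\<Phi>(u, w) = \<integral> |\<nabla>u|\<^bsup>p-2\<^esup>\<langle>\<nabla>u, \<nabla>w\<rangle> d\<mu>\<close> for the flux pairing. Everything rests on the tangent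
  inequality \<open>|w|\<^sup>p \<ge> |v|\<^sup>p + p |v|\<^bsup>p-2\<^esup>\<langle>v, w - v\<rangle>\<close> of the convex function \<open>|\<cdot>|\<^sup>p\<close>, which is strict
  for \<open>v \<noteq> w\<close> (\<open>ip_tangent_strict\<close>). Integrated over \<open>\<Omega>\<close>, it has three consequences.

  \<^item> Hoelder's inequality \<open>|\<Phi>(u, w)| \<le> \<parallel>\<nabla>u\<parallel>\<^bsup>p-1\<^esup> \<parallel>\<nabla>w\<parallel>\<close>, by rescaling \<open>w\<close> (\<open>field_holder\<close>).

  \<^item> The Euler-Lagrange equation: a Dirichlet solution \<open>u\<close> satisfies \<open>\<Phi>(u, v) = 0\<close> whenever \<open>v\<close> has
    trace zero (\<open>field_euler_lagrange\<close>, \<open>euler_lagrange\<close>).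

  \<^item> Uniqueness: given the Euler-Lagrange equation, equality of the energies of two solutions forces
    equality in the tangent inequality almost everywhere, hence equal gradients
    (\<open>field_energy_strict\<close>, \<open>solution_gradient_unique\<close>).

  Constants have vanishing gradient, so by the Euler-Lagrange equation \<open>\<Phi>(u, w)\<close> depends on \<open>w\<close> only
  through its trace modulo constants (\<open>flux_depends_on_trace\<close>), and by uniqueness it depends on \<open>u\<close>
  only through its boundary class. This makes \<open>L\<^sub>f(g) = \<Phi>(u\<^sub>f, Eg)\<close> well defined on classes and linear
  in \<open>g\<close>. That the solutions of all representatives of \<open>f\<close> form exactly one class of the homogeneous
  Newtonian space is the Poincare inequality: functions with equal gradients differ by a constant
  (\<open>poincare_zero_gradient_const\<close>).

  For the bound, minimality compares \<open>u\<^sub>f\<close> with the competitor \<open>Ef\<close>, and Hoelder's inequality gives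
  \<open>|L\<^sub>f(g)| \<le> \<parallel>\<nabla>u\<^sub>f\<parallel>\<^bsup>p-1\<^esup> \<parallel>\<nabla>Eg\<parallel> \<le> \<parallel>\<nabla>Ef\<parallel>\<^bsup>p-1\<^esup> \<parallel>\<nabla>Eg\<parallel> \<le> \<parallel>E\<parallel>\<^sup>p \<parallel>f\<parallel>\<^bsup>p-1\<^esup> \<parallel>g\<parallel>\<close>.

  Two measure theoretic points need care. A linear combination of Besov functions is again a Besov
  function, which requires additivity of the double integral, hence joint measurability of its kernel;
  this holds because doubling makes \<open>\<Omega>\<close> separable (\<open>besov_space_lincomb\<close>). On the other hand, the sum of
  two weak upper gradients is handled without any measurability along curves, since the lower
  integral is superadditive on arbitrary functions (\<open>nn_integral_superadditive\<close>).
\<close>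

section \<open>The p-th power of an inner product norm\<close>

text \<open>
  The mean value theorem for \<open>x \<mapsto> x\<^sup>p\<close>, whose derivative is strictly increasing; only the endpoint \<open>0\<close>
  has to be treated by hand.
\<close>

lemma powr_tangent_strict:
  fixes a c p :: real
  assumes "1 < p" "0 \<le> a" "0 \<le> c" "a \<noteq> c"
  shows "a powr p + p * a powr (p - 1) * (c - a) < c powr p"
proof -
  consider "a = 0" | "a > 0" "c = 0" | "0 < a" "0 < c" using assms by linarith
  then show ?thesis
  proof cases
    case 1 then show ?thesis using assms by simp
  next
    case 2
    then have "a powr (p - 1) * a = a powr p" by (simp add: powr_mult_base' powr_diff)
    then have "a powr p + p * a powr (p - 1) * (c - a) = (1 - p) * a powr p"
      using 2 by (simp add: algebra_simps)
    also have "\<dots> < 0" using 2 assms by (simp add: mult_neg_pos)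
    finally show ?thesis using 2 assms by simp
  next
    case 3
    have D: "((\<lambda>x. x powr p) has_real_derivative p * x powr (p - 1)) (at x)" if "0 < x" for x
      using has_real_derivative_powr[OF that] .
    show ?thesis
    proof (cases "a < c")
      case True
      obtain z where z: "a < z" "z < c" "c powr p - a powr p = (c - a) * (p * z powr (p - 1))"
        using MVT2[of a c "\<lambda>x. x powr p" "\<lambda>x. p * x powr (p - 1)"] True D 3 by force
      have "a powr (p - 1) < z powr (p - 1)" using z 3 assms by (intro powr_less_mono2) auto
      then have "(c - a) * (p * a powr (p - 1)) < (c - a) * (p * z powr (p - 1))"
        using True assms by simp
      then show ?thesis using z(3) by (simp add: algebra_simps)
    next
      case False
      then have ca: "c < a" using assms by simp
      obtain z where z: "c < z" "z < a" "a powr p - c powr p = (a - c) * (p * z powr (p - 1))"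
        using MVT2[of c a "\<lambda>x. x powr p" "\<lambda>x. p * x powr (p - 1)"] ca D 3 by force
      have "z powr (p - 1) < a powr (p - 1)" using z 3 assms by (intro powr_less_mono2) auto
      then have "(a - c) * (p * z powr (p - 1)) < (a - c) * (p * a powr (p - 1))"
        using ca assms by simp
      then show ?thesis using z(3) by (simp add: algebra_simps)
    qed
  qed
qed

lemma powr_add_le:
  fixes a b p :: real
  assumes "0 \<le> a" "0 \<le> b" "0 < p"
  shows "(a + b) powr p \<le> 2 powr p * (a powr p + b powr p)"
proof -
  have "(a + b) powr p \<le> (2 * max a b) powr p" using assms by (intro powr_mono2) auto
  also have "\<dots> = 2 powr p * (max a b) powr p" using assms by (simp add: powr_mult)
  also have "\<dots> \<le> 2 powr p * (a powr p + b powr p)"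
    using assms by (intro mult_left_mono) (auto simp: max_def)
  finally show ?thesis .
qed

definition ip_norm :: "(real ^ 'n::finite \<Rightarrow> real ^ 'n \<Rightarrow> real) \<Rightarrow> real ^ 'n \<Rightarrow> real" where
  "ip_norm b v = sqrt (b v v)"

definition ip_flux :: "real \<Rightarrow> (real ^ 'n::finite \<Rightarrow> real ^ 'n \<Rightarrow> real) \<Rightarrow> real ^ 'n \<Rightarrow> real ^ 'n \<Rightarrow> real" where
  "ip_flux p b v w = ip_norm b v powr (p - 2) * b v w"

context
  fixes b :: "real ^ 'n::finite \<Rightarrow> real ^ 'n \<Rightarrow> real"
  assumes ip: "is_inner_product b"
begin

lemma ip_bilinear: "bilinear b" and ip_sym: "b v w = b w v" and ip_pos: "v \<noteq> 0 \<Longrightarrow> 0 < b v v"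
  using ip unfolding is_inner_product_def by auto

lemmas ip_simps = bilinear_ladd[OF ip_bilinear] bilinear_radd[OF ip_bilinear]
  bilinear_lmul[OF ip_bilinear] bilinear_rmul[OF ip_bilinear]
  bilinear_lneg[OF ip_bilinear] bilinear_rneg[OF ip_bilinear]
  bilinear_lzero[OF ip_bilinear] bilinear_rzero[OF ip_bilinear]
  bilinear_lsub[OF ip_bilinear] bilinear_rsub[OF ip_bilinear]

lemma ip_nonneg: "0 \<le> b v v"
  by (cases "v = 0") (auto simp: ip_simps dest: ip_pos)

lemma ip_norm_nonneg: "0 \<le> ip_norm b v"
  by (simp add: ip_norm_def ip_nonneg)

lemma ip_norm_sq: "ip_norm b v * ip_norm b v = b v v"
  by (simp add: ip_norm_def ip_nonneg)

lemma ip_norm_eq_0: "ip_norm b v = 0 \<longleftrightarrow> v = 0"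
  using ip_pos[of v] by (cases "v = 0") (auto simp: ip_norm_def ip_simps)

lemma ip_norm_scale: "ip_norm b (t *\<^sub>R v) = \<bar>t\<bar> * ip_norm b v"
  by (simp add: ip_norm_def ip_simps real_sqrt_mult flip: mult.assoc)

lemma ip_cauchy_schwarz: "\<bar>b v w\<bar> \<le> ip_norm b v * ip_norm b w"
proof (cases "v = 0")
  case True then show ?thesis by (simp add: ip_simps ip_norm_def)
next
  case False
  then have pos: "0 < b v v" by (rule ip_pos)
  \<comment> \<open>\<open>t v\<close> is the orthogonal projection of \<open>w\<close> onto \<open>v\<close>.\<close>
  define t where "t = b v w / b v v"
  have "0 \<le> b (w - t *\<^sub>R v) (w - t *\<^sub>R v)" by (rule ip_nonneg)
  also have "\<dots> = b w w - 2 * t * b v w + t * t * b v v"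
    by (simp add: ip_simps ip_sym[of w v] algebra_simps)
  also have "\<dots> = b w w - (b v w)\<^sup>2 / b v v"
    using pos by (simp add: t_def power2_eq_square field_simps)
  finally have "(b v w)\<^sup>2 \<le> b v v * b w w" using pos by (simp add: field_simps)
  then have "sqrt ((b v w)\<^sup>2) \<le> sqrt (b v v * b w w)" by (rule real_sqrt_le_mono)
  then show ?thesis by (simp add: ip_norm_def real_sqrt_mult)
qed

lemma ip_triangle: "ip_norm b (v + w) \<le> ip_norm b v + ip_norm b w"
proof (rule power2_le_imp_le)
  have "(ip_norm b (v + w))\<^sup>2 = b v v + 2 * b v w + b w w"
    by (simp add: power2_eq_square ip_norm_sq ip_simps ip_sym[of w v])
  also have "\<dots> \<le> b v v + 2 * (ip_norm b v * ip_norm b w) + b w w"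
    using ip_cauchy_schwarz[of v w] by linarith
  also have "\<dots> = (ip_norm b v + ip_norm b w)\<^sup>2"
    by (simp add: power2_eq_square algebra_simps ip_norm_sq)
  finally show "(ip_norm b (v + w))\<^sup>2 \<le> (ip_norm b v + ip_norm b w)\<^sup>2" .
qed (simp add: ip_norm_nonneg)

text \<open>
  Cauchy-Schwarz. At \<open>v = 0\<close> both sides vanish, whatever the sign of \<open>p - 2\<close>.
\<close>

lemma ip_flux_bound: "\<bar>ip_flux p b v w\<bar> \<le> ip_norm b v powr (p - 1) * ip_norm b w"
proof (cases "v = 0")
  case True then show ?thesis by (simp add: ip_flux_def ip_simps ip_norm_nonneg)
next
  case False
  then have n: "0 < ip_norm b v" using ip_norm_eq_0 ip_norm_nonneg by (simp add: less_le)
  have "\<bar>ip_flux p b v w\<bar> \<le> ip_norm b v powr (p - 2) * (ip_norm b v * ip_norm b w)"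
    by (simp add: ip_flux_def abs_mult ip_cauchy_schwarz mult_left_mono)
  also have "\<dots> = ip_norm b v powr (p - 1) * ip_norm b w"
    using n powr_mult_base[of "ip_norm b v" "p - 2"] by (simp add: mult_ac)
  finally show ?thesis .
qed

lemma ip_flux_self: "ip_flux p b v v = ip_norm b v powr p"
proof (cases "v = 0")
  case True then show ?thesis by (simp add: ip_flux_def ip_simps ip_norm_def)
next
  case False
  then have n: "0 < ip_norm b v" using ip_norm_eq_0 ip_norm_nonneg by (simp add: less_le)
  have "ip_norm b v powr p = ip_norm b v powr (p - 2) * (ip_norm b v) powr 2"
    by (simp flip: powr_add)
  also have "(ip_norm b v) powr 2 = b v v"
    using n by (simp add: powr_numeral power2_eq_square ip_norm_sq)
  finally show ?thesis by (simp add: ip_flux_def)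
qed

lemma ip_flux_add: "ip_flux p b v (w + w') = ip_flux p b v w + ip_flux p b v w'"
  by (simp add: ip_flux_def ip_simps algebra_simps)

lemma ip_flux_scale: "ip_flux p b v (s *\<^sub>R w) = s * ip_flux p b v w"
  by (simp add: ip_flux_def ip_simps)

lemma ip_flux_diff: "ip_flux p b v (w - w') = ip_flux p b v w - ip_flux p b v w'"
  by (simp add: ip_flux_def ip_simps algebra_simps)

text \<open>
  By Cauchy-Schwarz the claim reduces to the scalar inequality for the two norms. That one is strict
  unless the norms agree; if they do and \<open>v \<noteq> w\<close>, then Cauchy-Schwarz itself is strict.
\<close>

lemma ip_tangent_strict:
  assumes "1 < p" "v \<noteq> w"
  shows "ip_norm b v powr p + p * ip_flux p b v (w - v) < ip_norm b w powr p"
proof -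
  let ?a = "ip_norm b v" and ?c = "ip_norm b w"
  have le: "ip_flux p b v w \<le> ?a powr (p - 1) * ?c" using ip_flux_bound[of p v w] by linarith
  have aa: "?a powr (p - 1) * ?a = ?a powr p"
    using powr_mult_base[OF ip_norm_nonneg, of v "p - 1"] by (simp add: mult.commute)
  have eq: "?a powr p + p * ip_flux p b v (w - v) = ?a powr p + p * (ip_flux p b v w - ?a powr p)"
    by (simp add: ip_flux_diff ip_flux_self)
  show ?thesis
  proof (cases "?a = ?c")
    case False
    have "?a powr p + p * (ip_flux p b v w - ?a powr p)
        \<le> ?a powr p + p * (?a powr (p - 1) * ?c - ?a powr p)"
      using le assms by simp
    also have "\<dots> = ?a powr p + p * ?a powr (p - 1) * (?c - ?a)"
      by (simp add: algebra_simps flip: aa)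
    also have "\<dots> < ?c powr p"
      using powr_tangent_strict[OF assms(1) ip_norm_nonneg ip_norm_nonneg False] .
    finally show ?thesis unfolding eq .
  next
    case True
    have "0 < b (v - w) (v - w)" using assms by (intro ip_pos) simp
    also have "\<dots> = b v v + b w w - 2 * b v w" by (simp add: ip_simps ip_sym[of w v])
    also have "\<dots> = 2 * (b v v - b v w)" using True ip_norm_sq[of v] ip_norm_sq[of w] by simp
    finally have lt: "b v w < b v v" by simp
    have "v \<noteq> 0" using True assms ip_norm_eq_0 by metis
    then have "0 < ?a" using ip_norm_eq_0 ip_norm_nonneg by (simp add: less_le)
    then have "ip_flux p b v w < ip_flux p b v v" using lt by (simp add: ip_flux_def)
    then have "p * (ip_flux p b v w - ?a powr p) < 0"
      using assms by (simp add: ip_flux_self mult_pos_neg)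
    then show ?thesis unfolding eq using True by simp
  qed
qed

lemma ip_tangent:
  assumes "1 < p"
  shows "ip_norm b v powr p + p * ip_flux p b v (w - v) \<le> ip_norm b w powr p"
  using ip_tangent_strict[OF assms, of v w] by (cases "v = w") (auto simp: ip_flux_def ip_simps)

text \<open>
  The map \<open>v \<mapsto> |v|\<^bsup>p-2\<^esup> v\<close> is continuous. At the origin this comes from its size \<open>|v|\<^bsup>p-1\<^esup>\<close> and
  \<open>p > 1\<close>, not from continuity of the factors.
\<close>

lemma ip_flux_tendsto:
  assumes "1 < p" and t: "t \<longlonglongrightarrow> 0"
  shows "(\<lambda>n. ip_flux p b (v + t n *\<^sub>R w) w) \<longlonglongrightarrow> ip_flux p b v w"
proof (cases "v = 0")
  case False
  have "(\<lambda>n. sqrt (b v v + 2 * t n * b v w + t n * t n * b w w))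
          \<longlonglongrightarrow> sqrt (b v v + 2 * 0 * b v w + 0 * 0 * b w w)"
    by (intro tendsto_intros t)
  moreover have "ip_norm b (v + t n *\<^sub>R w) = sqrt (b v v + 2 * t n * b v w + t n * t n * b w w)" for n
    by (simp add: ip_norm_def ip_simps ip_sym[of w v] algebra_simps)
  ultimately have N: "(\<lambda>n. ip_norm b (v + t n *\<^sub>R w)) \<longlonglongrightarrow> ip_norm b v" by (simp add: ip_norm_def)
  have "(\<lambda>n. b v w + t n * b w w) \<longlonglongrightarrow> b v w + 0 * b w w" by (intro tendsto_intros t)
  then have P: "(\<lambda>n. b (v + t n *\<^sub>R w) w) \<longlonglongrightarrow> b v w" by (simp add: ip_simps)
  show ?thesis unfolding ip_flux_def
    using False ip_norm_eq_0[of v] by (intro tendsto_mult tendsto_powr N P tendsto_const) simp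
next
  case True
  have "(\<lambda>n. (\<bar>t n\<bar> * ip_norm b w) powr (p - 1) * ip_norm b w)
          \<longlonglongrightarrow> (\<bar>0\<bar> * ip_norm b w) powr (p - 1) * ip_norm b w"
    using assms(1) by (intro tendsto_intros t tendsto_powr')
      (auto simp: ip_norm_nonneg)
  then have "(\<lambda>n. (\<bar>t n\<bar> * ip_norm b w) powr (p - 1) * ip_norm b w) \<longlonglongrightarrow> 0" by simp
  then have "(\<lambda>n. ip_flux p b (v + t n *\<^sub>R w) w) \<longlonglongrightarrow> 0"
    by (rule Lim_null_comparison[rotated])
       (use True ip_flux_bound[of p "t _ *\<^sub>R w" w] in \<open>simp add: ip_norm_scale\<close>)
  then show ?thesis using True by (simp add: ip_flux_def ip_simps)
qed

lemma ip_powr_add_le: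
  assumes "0 < p"
  shows "ip_norm b (v + w) powr p \<le> 2 powr p * (ip_norm b v powr p + ip_norm b w powr p)"
proof -
  have "ip_norm b (v + w) powr p \<le> (ip_norm b v + ip_norm b w) powr p"
    using assms by (intro powr_mono2 ip_triangle ip_norm_nonneg) auto
  also have "\<dots> \<le> 2 powr p * (ip_norm b v powr p + ip_norm b w powr p)"
    using assms by (intro powr_add_le ip_norm_nonneg)
  finally show ?thesis .
qed

text \<open>
  The majorant, independent of \<open>t\<close>, for passing to the limit \<open>t \<rightarrow> 0\<close> under the integral.
\<close>

lemma ip_flux_dominated:
  assumes "1 < p" "\<bar>t\<bar> \<le> 1"
  shows "\<bar>ip_flux p b (v + t *\<^sub>R w) w\<bar> \<le> 2 powr p * (ip_norm b v powr p + ip_norm b w powr p)"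
proof -
  let ?s = "ip_norm b v + ip_norm b w"
  have s: "0 \<le> ?s" "ip_norm b w \<le> ?s" using ip_norm_nonneg by simp_all
  have "ip_norm b (v + t *\<^sub>R w) \<le> ip_norm b v + \<bar>t\<bar> * ip_norm b w"
    using ip_triangle[of v "t *\<^sub>R w"] by (simp add: ip_norm_scale)
  also have "\<dots> \<le> ?s" using assms ip_norm_nonneg[of w] by (simp add: mult_left_le_one_le)
  finally have "ip_norm b (v + t *\<^sub>R w) powr (p - 1) \<le> ?s powr (p - 1)"
    using assms ip_norm_nonneg by (intro powr_mono2) auto
  then have "ip_norm b (v + t *\<^sub>R w) powr (p - 1) * ip_norm b w \<le> ?s powr (p - 1) * ?s"
    using s ip_norm_nonneg by (intro mult_mono) auto
  also have "\<dots> = ?s powr p" using powr_mult_base[OF s(1), of "p - 1"] by (simp add: mult.commute)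
  also have "\<dots> \<le> 2 powr p * (ip_norm b v powr p + ip_norm b w powr p)"
    using assms by (intro powr_add_le ip_norm_nonneg) auto
  finally show ?thesis using ip_flux_bound[of p "v + t *\<^sub>R w" w] by linarith
qed

end

section \<open>The p-energy of vector fields\<close>

text \<open>
  An inner product on each fibre \<open>\<real>\<^sup>n\<close>, varying measurably with the base point: the part of a Cheeger
  structure that matters for vector fields, of which gradients are examples.
\<close>

locale fibre_metric =
  fixes M :: "'a measure" and B :: "'a \<Rightarrow> real ^ 'n::finite \<Rightarrow> real ^ 'n \<Rightarrow> real" and p :: real
  assumes p_gt_1: "1 < p"
    and fibre_ip: "x \<in> space M \<Longrightarrow> is_inner_product (B x)"
    and fibre_measurable: "(\<lambda>x. B x v w) \<in> borel_measurable M"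
begin

definition Lp_field :: "('a \<Rightarrow> real ^ 'n) \<Rightarrow> bool" where
  "Lp_field U \<longleftrightarrow> U \<in> borel_measurable M \<and> integrable M (\<lambda>x. ip_norm (B x) (U x) powr p)"

definition field_energy :: "('a \<Rightarrow> real ^ 'n) \<Rightarrow> real" where
  "field_energy U = (LINT x|M. ip_norm (B x) (U x) powr p)"

abbreviation field_flux :: "('a \<Rightarrow> real ^ 'n) \<Rightarrow> ('a \<Rightarrow> real ^ 'n) \<Rightarrow> 'a \<Rightarrow> real" where
  "field_flux U W \<equiv> \<lambda>x. ip_flux p (B x) (U x) (W x)"

text \<open>
  Only constant vectors are measurable by assumption; a field is reduced to them by expanding it in the
  standard basis.
\<close>

lemma measurable_fibre:
  assumes [measurable]: "U \<in> borel_measurable M" "W \<in> borel_measurable M"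
  shows "(\<lambda>x. B x (U x) (W x)) \<in> borel_measurable M"
proof -
  note fibre_measurable[measurable]
  have eq: "B x (U x) (W x) = (\<Sum>i\<in>Basis. \<Sum>j\<in>Basis. (U x \<bullet> i) * ((W x \<bullet> j) * B x i j))"
    if "x \<in> space M" for x
  proof -
    have bl: "bilinear (B x)" using fibre_ip[OF that] by (simp add: is_inner_product_def)
    then interpret l: linear "\<lambda>v. B x v (W x)" by (simp add: bilinear_def)
    have r: "linear (B x i)" for i using bl by (simp add: bilinear_def)
    have "B x (U x) (W x) = B x (\<Sum>i\<in>Basis. (U x \<bullet> i) *\<^sub>R i) (W x)"
      by (simp add: euclidean_representation)
    also have "\<dots> = (\<Sum>i\<in>Basis. (U x \<bullet> i) * B x i (W x))" by (simp add: l.sum l.scale)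
    also have "\<dots> = (\<Sum>i\<in>Basis. (U x \<bullet> i) * B x i (\<Sum>j\<in>Basis. (W x \<bullet> j) *\<^sub>R j))"
      by (simp add: euclidean_representation)
    also have "\<dots> = (\<Sum>i\<in>Basis. (U x \<bullet> i) * (\<Sum>j\<in>Basis. (W x \<bullet> j) * B x i j))"
      by (simp add: linear_sum[OF r] linear_scale[OF r])
    finally show ?thesis by (simp add: sum_distrib_left)
  qed
  show ?thesis by (subst measurable_cong[OF eq]) measurable
qed

lemma measurable_field_norm:
  assumes "U \<in> borel_measurable M"
  shows "(\<lambda>x. ip_norm (B x) (U x)) \<in> borel_measurable M"
  unfolding ip_norm_def using measurable_fibre[OF assms assms] by measurable

lemma measurable_field_flux:
  assumes "U \<in> borel_measurable M" "W \<in> borel_measurable M"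
  shows "field_flux U W \<in> borel_measurable M"
  unfolding ip_flux_def using measurable_fibre[OF assms] measurable_field_norm[OF assms(1)] by measurable

lemma Lp_field_scale:
  assumes "Lp_field U"
  shows "Lp_field (\<lambda>x. t *\<^sub>R U x)" "field_energy (\<lambda>x. t *\<^sub>R U x) = \<bar>t\<bar> powr p * field_energy U"
proof -
  have eq: "ip_norm (B x) (t *\<^sub>R U x) powr p = \<bar>t\<bar> powr p * ip_norm (B x) (U x) powr p"
    if "x \<in> space M" for x
    using that by (simp add: ip_norm_scale fibre_ip powr_mult ip_norm_nonneg)
  show "Lp_field (\<lambda>x. t *\<^sub>R U x)"
    using assms by (auto simp: Lp_field_def eq cong: Bochner_Integration.integrable_cong)
  show "field_energy (\<lambda>x. t *\<^sub>R U x) = \<bar>t\<bar> powr p * field_energy U"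
    by (simp add: field_energy_def eq cong: Bochner_Integration.integral_cong)
qed

lemma Lp_field_add:
  assumes "Lp_field U" "Lp_field W"
  shows "Lp_field (\<lambda>x. U x + W x)"
proof -
  have m[measurable]: "U \<in> borel_measurable M" "W \<in> borel_measurable M"
    using assms by (auto simp: Lp_field_def)
  have "integrable M (\<lambda>x. 2 powr p * (ip_norm (B x) (U x) powr p + ip_norm (B x) (W x) powr p))"
    using assms by (auto simp: Lp_field_def)
  then have "integrable M (\<lambda>x. ip_norm (B x) (U x + W x) powr p)"
  proof (rule Bochner_Integration.integrable_bound)
    show "(\<lambda>x. ip_norm (B x) (U x + W x) powr p) \<in> borel_measurable M"
      using measurable_field_norm[of "\<lambda>x. U x + W x"] by measurable
    show "AE x in M. norm (ip_norm (B x) (U x + W x) powr p)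
            \<le> norm (2 powr p * (ip_norm (B x) (U x) powr p + ip_norm (B x) (W x) powr p))"
      by (rule AE_I2) (use ip_powr_add_le[OF fibre_ip] p_gt_1 in auto)
  qed
  then show ?thesis by (simp add: Lp_field_def)
qed

lemma Lp_field_diff:
  assumes "Lp_field U" "Lp_field W"
  shows "Lp_field (\<lambda>x. W x - U x)"
  using Lp_field_add[OF assms(2) Lp_field_scale(1)[OF assms(1), of "-1"]] by simp

lemma integrable_field_flux:
  assumes "Lp_field U" "Lp_field W"
  shows "integrable M (field_flux U W)"
proof -
  have m[measurable]: "U \<in> borel_measurable M" "W \<in> borel_measurable M"
    using assms by (auto simp: Lp_field_def)
  have "integrable M (\<lambda>x. 2 powr p * (ip_norm (B x) (U x) powr p + ip_norm (B x) (W x) powr p))"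
    using assms by (auto simp: Lp_field_def)
  then show ?thesis
  proof (rule Bochner_Integration.integrable_bound)
    show "field_flux U W \<in> borel_measurable M" by (rule measurable_field_flux[OF m])
    show "AE x in M. norm (field_flux U W x)
            \<le> norm (2 powr p * (ip_norm (B x) (U x) powr p + ip_norm (B x) (W x) powr p))"
      by (rule AE_I2) (use ip_flux_dominated[OF fibre_ip p_gt_1, of _ 0] in force)
  qed
qed

lemma field_energy_nonneg: "0 \<le> field_energy U"
  by (simp add: field_energy_def)

lemma field_tangent:
  assumes "Lp_field U" "Lp_field W"
  shows "field_energy U + p * (LINT x|M. field_flux U (\<lambda>x. W x - U x) x) \<le> field_energy W"
proof -
  note fl = integrable_field_flux[OF assms(1) Lp_field_diff[OF assms]]
  have iU: "integrable M (\<lambda>x. ip_norm (B x) (U x) powr p)"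
    and iW: "integrable M (\<lambda>x. ip_norm (B x) (W x) powr p)" using assms by (auto simp: Lp_field_def)
  have "field_energy U + p * (LINT x|M. field_flux U (\<lambda>x. W x - U x) x)
      = (LINT x|M. ip_norm (B x) (U x) powr p + p * field_flux U (\<lambda>x. W x - U x) x)"
    using fl iU by (simp add: field_energy_def)
  also have "\<dots> \<le> field_energy W" unfolding field_energy_def
    using fl iU iW by (intro integral_mono) (auto intro!: ip_tangent[OF fibre_ip p_gt_1])
  finally show ?thesis .
qed

lemma field_flux_null:
  assumes "Lp_field U" "Lp_field W" "field_energy U = 0 \<or> field_energy W = 0"
  shows "(LINT x|M. field_flux U W x) = 0"
proof -
  have z: "AE x in M. V x = 0" if "Lp_field V" "field_energy V = 0" for V
  proof -
    have "AE x in M. ip_norm (B x) (V x) powr p = 0"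
      using that by (subst (asm) Lp_field_def, subst (asm) field_energy_def)
        (auto simp: integral_nonneg_eq_0_iff_AE)
    then show ?thesis using AE_space[of M]
      by eventually_elim (simp add: ip_norm_eq_0[OF fibre_ip])
  qed
  have "AE x in M. U x = 0 \<or> W x = 0"
    using assms(3)
  proof
    assume "field_energy U = 0"
    from z[OF assms(1) this] show ?thesis by eventually_elim simp
  next
    assume "field_energy W = 0"
    from z[OF assms(2) this] show ?thesis by eventually_elim simp
  qed
  then have "AE x in M. field_flux U W x = 0"
    using AE_space[of M] by eventually_elim (auto simp: ip_flux_def ip_simps[OF fibre_ip])
  then show ?thesis by (rule integral_eq_zero_AE)
qed

text \<open>
  The tangent inequality at \<open>U\<close> towards \<open>s W\<close> reads
  \<open>p s \<integral>\<langle>|U|\<^bsup>p-2\<^esup>U, W\<rangle> \<le> |s|\<^sup>p \<parallel>W\<parallel>\<^sup>p + (p - 1) \<parallel>U\<parallel>\<^sup>p\<close> for every real \<open>s\<close>; the optimal choice is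
  \<open>s = \<plusminus>\<parallel>U\<parallel> / \<parallel>W\<parallel>\<close>, where the right-hand side equals \<open>p \<parallel>U\<parallel>\<^sup>p\<close>.
\<close>

lemma field_holder:
  assumes U: "Lp_field U" and W: "Lp_field W"
  shows "\<bar>LINT x|M. field_flux U W x\<bar>
           \<le> field_energy U powr ((p - 1) / p) * field_energy W powr (1 / p)"
proof (cases "field_energy U = 0 \<or> field_energy W = 0")
  case True
  then show ?thesis using field_flux_null[OF assms True] by simp
next
  case False
  define a where "a = field_energy U powr (1 / p)"
  define c where "c = field_energy W powr (1 / p)"
  define I where "I = (LINT x|M. field_flux U W x)"
  have pos: "0 < a" "0 < c" using False by (auto simp: a_def c_def)
  have ap: "a powr p = field_energy U" and cp: "c powr p = field_energy W"
    using p_gt_1 field_energy_nonneg by (auto simp: a_def c_def powr_powr)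
  have bound: "p * s * I \<le> \<bar>s\<bar> powr p * c powr p + (p - 1) * a powr p" for s
  proof -
    note sW = Lp_field_scale[OF W, of s]
    have "(LINT x|M. field_flux U (\<lambda>x. s *\<^sub>R W x - U x) x)
        = (LINT x|M. s * field_flux U W x - ip_norm (B x) (U x) powr p)"
      by (rule Bochner_Integration.integral_cong)
        (simp_all add: ip_flux_diff[OF fibre_ip] ip_flux_self[OF fibre_ip] ip_flux_scale[OF fibre_ip])
    also have "\<dots> = s * I - field_energy U"
      using U integrable_field_flux[OF U W] by (simp add: Lp_field_def field_energy_def I_def)
    finally have "field_energy U + p * (s * I - field_energy U) \<le> \<bar>s\<bar> powr p * field_energy W"
      using field_tangent[OF U sW(1)] sW(2) by simp
    then show ?thesis by (simp add: ap cp algebra_simps)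
  qed
  have "p * (a / c) * \<bar>I\<bar> \<le> (a / c) powr p * c powr p + (p - 1) * a powr p"
  proof -
    have "\<bar>a / c\<bar> = a / c" "\<bar>- (a / c)\<bar> = a / c" using pos by simp_all
    with bound[of "a / c"] bound[of "- (a / c)"] show ?thesis by (cases "0 \<le> I") simp_all
  qed
  also have "(a / c) powr p * c powr p = a powr p" using pos by (simp add: powr_divide)
  finally have "p * ((a / c) * \<bar>I\<bar>) \<le> p * a powr p" by (simp add: algebra_simps)
  then have "(a / c) * \<bar>I\<bar> \<le> a powr p" using p_gt_1 by (rule_tac mult_left_le_imp_le[of p]) auto
  also have "a powr p = a * a powr (p - 1)" using pos by (simp add: powr_mult_base)
  finally have "\<bar>I\<bar> \<le> a powr (p - 1) * c" using pos by (simp add: field_simps)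
  moreover have "a powr (p - 1) = field_energy U powr ((p - 1) / p)"
    by (simp add: a_def powr_powr)
  ultimately show ?thesis by (simp add: I_def c_def)
qed

text \<open>
  Rather than differentiating the energy under the integral, apply the tangent inequality at
  \<open>U + t W\<close> towards \<open>U\<close>: minimality of \<open>U\<close> makes the flux of \<open>U + t W\<close> against \<open>W\<close> nonnegative for each
  \<open>t > 0\<close>. Letting \<open>t \<rightarrow> 0\<close> then needs only continuity of the flux.
\<close>

lemma field_variation_nonneg:
  assumes U: "Lp_field U" and W: "Lp_field W"
    and min: "\<And>t. 0 < t \<Longrightarrow> field_energy U \<le> field_energy (\<lambda>x. U x + t *\<^sub>R W x)"
  shows "0 \<le> (LINT x|M. field_flux U W x)"
proof -
  define t :: "nat \<Rightarrow> real" where "t n = 1 / real (Suc n)" for n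
  have t: "0 < t n" "\<bar>t n\<bar> \<le> 1" for n by (auto simp: t_def)
  have t0: "t \<longlonglongrightarrow> 0" unfolding t_def by (rule LIMSEQ_Suc[OF lim_1_over_n])
  let ?V = "\<lambda>n x. U x + t n *\<^sub>R W x"
  have V: "Lp_field (?V n)" for n by (intro Lp_field_add U Lp_field_scale(1) W)
  have nonneg: "0 \<le> (LINT x|M. field_flux (?V n) W x)" for n
  proof -
    have "(LINT x|M. field_flux (?V n) (\<lambda>x. U x - ?V n x) x)
        = (LINT x|M. - t n * field_flux (?V n) W x)"
      by (rule Bochner_Integration.integral_cong) (auto simp: ip_flux_def ip_simps[OF fibre_ip])
    also have "\<dots> = - t n * (LINT x|M. field_flux (?V n) W x)" by simp
    finally have "p * t n * (LINT x|M. field_flux (?V n) W x) \<ge> 0"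
      using field_tangent[OF V[of n] U] min[OF t(1)[of n]] by simp
    moreover have "0 < p * t n" using p_gt_1 t(1)[of n] by simp
    ultimately show ?thesis by (simp only: zero_le_mult_iff) linarith
  qed
  have m: "U \<in> borel_measurable M" "W \<in> borel_measurable M" "\<And>n. ?V n \<in> borel_measurable M"
    using U W V by (auto simp: Lp_field_def)
  have "(\<lambda>n. LINT x|M. field_flux (?V n) W x) \<longlonglongrightarrow> (LINT x|M. field_flux U W x)"
  proof (rule integral_dominated_convergence)
    show "integrable M (\<lambda>x. 2 powr p * (ip_norm (B x) (U x) powr p + ip_norm (B x) (W x) powr p))"
      using U W by (auto simp: Lp_field_def)
    show "AE x in M. (\<lambda>n. field_flux (?V n) W x) \<longlonglongrightarrow> field_flux U W x"
      by (rule AE_I2) (rule ip_flux_tendsto[OF fibre_ip p_gt_1 t0])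
    show "AE x in M. norm (field_flux (?V n) W x)
        \<le> 2 powr p * (ip_norm (B x) (U x) powr p + ip_norm (B x) (W x) powr p)" for n
      by (rule AE_I2) (simp add: ip_flux_dominated[OF fibre_ip p_gt_1 t(2)])
  qed (auto intro: measurable_field_flux m)
  then show ?thesis by (rule LIMSEQ_le_const) (auto intro: nonneg)
qed

lemma field_euler_lagrange:
  assumes U: "Lp_field U" and W: "Lp_field W"
    and min: "\<And>t. field_energy U \<le> field_energy (\<lambda>x. U x + t *\<^sub>R W x)"
  shows "(LINT x|M. field_flux U W x) = 0"
proof -
  have "(LINT x|M. field_flux U (\<lambda>x. (-1) *\<^sub>R W x) x) = (LINT x|M. - field_flux U W x)"
    by (rule Bochner_Integration.integral_cong) (auto simp: ip_flux_def ip_simps[OF fibre_ip])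
  moreover have "0 \<le> (LINT x|M. field_flux U (\<lambda>x. (-1) *\<^sub>R W x) x)"
    using min[of "- _"] by (intro field_variation_nonneg U Lp_field_scale(1) W) simp
  moreover have "0 \<le> (LINT x|M. field_flux U W x)"
    by (intro field_variation_nonneg U W min)
  ultimately show ?thesis by simp
qed

text \<open>
  The defect in the tangent inequality is nonnegative with integral at most \<open>0\<close>, so it vanishes almost
  everywhere, and strictness identifies the two fields.
\<close>

lemma field_energy_strict:
  assumes U: "Lp_field U" and W: "Lp_field W"
    and flux: "(LINT x|M. field_flux U (\<lambda>x. W x - U x) x) = 0"
    and le: "field_energy W \<le> field_energy U"
  shows "AE x in M. U x = W x"
proof -
  note fl = integrable_field_flux[OF U Lp_field_diff[OF U W]]
  have iU: "integrable M (\<lambda>x. ip_norm (B x) (U x) powr p)"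
    and iW: "integrable M (\<lambda>x. ip_norm (B x) (W x) powr p)" using U W by (auto simp: Lp_field_def)
  let ?d = "\<lambda>x. ip_norm (B x) (W x) powr p
    - (ip_norm (B x) (U x) powr p + p * field_flux U (\<lambda>x. W x - U x) x)"
  have i: "integrable M ?d" using fl iU iW by simp
  have "(LINT x|M. ?d x) = field_energy W - field_energy U"
    using fl iU iW flux by (simp add: field_energy_def)
  moreover have nn: "AE x in M. 0 \<le> ?d x"
    by (rule AE_I2) (use ip_tangent[OF fibre_ip p_gt_1] in auto)
  moreover have "0 \<le> (LINT x|M. ?d x)" using nn by (rule integral_nonneg_AE)
  ultimately have "(LINT x|M. ?d x) = 0" using le by simp
  then have "AE x in M. ?d x = 0" using integral_nonneg_eq_0_iff_AE[OF i nn] by simp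
  then show ?thesis using AE_space[of M]
  proof eventually_elim
    case (elim x)
    then show ?case using ip_tangent_strict[OF fibre_ip[OF elim(2)] p_gt_1, of "U x" "W x"] by force
  qed
qed

end

section \<open>Powers and p-norms of extended functions\<close>

lemma enn_powr_ennreal: "0 \<le> r \<Longrightarrow> enn_powr (ennreal r) a = ennreal (r powr a)"
  by (simp add: enn_powr_def)

lemma enn_powr_0 [simp]: "enn_powr 0 a = 0"
  by (simp add: enn_powr_def)

lemma enn_powr_top [simp]: "enn_powr top a = top"
  by (simp add: enn_powr_def)

lemma enn_powr_eq_0_iff: "enn_powr x a = 0 \<longleftrightarrow> x = 0"
  by (cases x) (auto simp: enn_powr_def)

lemma enn_powr_finite_iff: "enn_powr x a < \<infinity> \<longleftrightarrow> x < \<infinity>"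
  by (cases x) (auto simp: enn_powr_def)

lemma enn_powr_mono: "0 < a \<Longrightarrow> x \<le> y \<Longrightarrow> enn_powr x a \<le> enn_powr y a"
  by (cases x; cases y) (auto simp: enn_powr_def powr_mono2 top_unique)

lemma enn_powr_measurable [measurable]: "(\<lambda>x. enn_powr x a) \<in> borel_measurable borel"
  unfolding enn_powr_def by measurable

lemma enn_powr_mult: "enn_powr (ennreal t * x) a = enn_powr (ennreal t) a * enn_powr x a"
proof (cases x)
  case (real r)
  show ?thesis
  proof (cases "0 \<le> t")
    case True
    then show ?thesis using real
      by (simp add: enn_powr_ennreal powr_mult flip: ennreal_mult)
  qed (simp add: ennreal_neg)
next
  case top
  then show ?thesis
    by (cases "0 < t") (auto simp: enn_powr_ennreal ennreal_mult_top ennreal_neg)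
qed

lemma enn_powr_add_le:
  assumes "0 < a"
  shows "enn_powr (x + y) a \<le> ennreal (2 powr a) * (enn_powr x a + enn_powr y a)"
proof (cases "x = \<infinity> \<or> y = \<infinity>")
  case True
  then show ?thesis by (auto simp: ennreal_mult_top)
next
  case False
  then obtain r s where "x = ennreal r" "0 \<le> r" "y = ennreal s" "0 \<le> s"
    by (cases x; cases y) auto
  then show ?thesis using powr_add_le[of r s a] assms
    by (simp add: enn_powr_ennreal flip: ennreal_plus ennreal_mult)
qed

lemma enn_Lp_norm_finite_iff: "enn_Lp_norm p M g < \<infinity> \<longleftrightarrow> (\<integral>\<^sup>+x. enn_powr (g x) p \<partial>M) < \<infinity>"
  by (simp only: enn_Lp_norm_def enn_powr_finite_iff)

lemma enn_Lp_norm_eq_0_iff: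
  assumes [measurable]: "g \<in> borel_measurable M"
  shows "enn_Lp_norm p M g = 0 \<longleftrightarrow> (AE x in M. g x = 0)"
  by (simp add: enn_Lp_norm_def enn_powr_eq_0_iff nn_integral_0_iff_AE)

lemma enn_Lp_norm_lincomb_finite:
  assumes [measurable]: "g \<in> borel_measurable M" "h \<in> borel_measurable M"
    and p: "0 < p" and "enn_Lp_norm p M g < \<infinity>" "enn_Lp_norm p M h < \<infinity>"
  shows "enn_Lp_norm p M (\<lambda>x. ennreal a * g x + ennreal b * h x) < \<infinity>"
proof -
  let ?A = "enn_powr (ennreal a) p" and ?B = "enn_powr (ennreal b) p"
  have "(\<integral>\<^sup>+x. enn_powr (ennreal a * g x + ennreal b * h x) p \<partial>M)
      \<le> (\<integral>\<^sup>+x. ennreal (2 powr p) * (?A * enn_powr (g x) p + ?B * enn_powr (h x) p) \<partial>M)"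
    using p by (intro nn_integral_mono) (metis enn_powr_add_le enn_powr_mult)
  also have "\<dots> = ennreal (2 powr p) *
      (?A * (\<integral>\<^sup>+x. enn_powr (g x) p \<partial>M) + ?B * (\<integral>\<^sup>+x. enn_powr (h x) p \<partial>M))"
    by (simp add: nn_integral_cmult nn_integral_add)
  also have "\<dots> < \<infinity>"
  proof -
    have "?A < \<infinity>" "?B < \<infinity>" by (simp_all add: enn_powr_def)
    then show ?thesis using assms(4,5) unfolding enn_Lp_norm_finite_iff
      by (simp add: ennreal_mult_less_top)
  qed
  finally show ?thesis unfolding enn_Lp_norm_finite_iff .
qed

section \<open>Weak upper gradients\<close>

text \<open>
  The integral of an arbitrary function is the supremum over the simple functions below it, and sums of
  such functions lie below the sum. Arc length parametrisations enter curve integrals through a choice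
  of parameter, so this is what replaces additivity there.
\<close>

lemma nn_integral_superadditive: "(\<integral>\<^sup>+x. f x \<partial>M) + (\<integral>\<^sup>+x. g x \<partial>M) \<le> (\<integral>\<^sup>+x. f x + g x \<partial>M)"
proof -
  let ?S = "\<lambda>f. {s. simple_function M s \<and> s \<le> f}"
  have ne: "?S f \<noteq> {}" for f :: "'a \<Rightarrow> ennreal"
    by (auto intro!: exI[of _ "\<lambda>_. 0"] simp: le_fun_def)
  have "(SUP s\<in>?S f. integral\<^sup>S M s) + (SUP t\<in>?S g. integral\<^sup>S M t)
      = (SUP s\<in>?S f. SUP t\<in>?S g. integral\<^sup>S M s + integral\<^sup>S M t)"
    by (subst ennreal_SUP_add_left[OF ne, symmetric], subst ennreal_SUP_add_right[OF ne]) (rule refl)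
  also have "\<dots> \<le> (SUP r\<in>?S (\<lambda>x. f x + g x). integral\<^sup>S M r)"
  proof (intro SUP_least)
    fix s t assume s: "s \<in> ?S f" and t: "t \<in> ?S g"
    have "(\<lambda>x. s x + t x) \<in> ?S (\<lambda>x. f x + g x)"
      using s t by (auto simp: le_fun_def intro!: add_mono)
    moreover have "integral\<^sup>S M s + integral\<^sup>S M t = integral\<^sup>S M (\<lambda>x. s x + t x)"
      using s t by simp
    ultimately show "integral\<^sup>S M s + integral\<^sup>S M t \<le> (SUP r\<in>?S (\<lambda>x. f x + g x). integral\<^sup>S M r)"
      by (metis (no_types, lifting) SUP_upper)
  qed
  finally show ?thesis by (simp add: nn_integral_def)
qed

lemma nn_integral_cmult_ge: "c * (\<integral>\<^sup>+x. f x \<partial>M) \<le> (\<integral>\<^sup>+x. c * f x \<partial>M)"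
proof -
  let ?S = "\<lambda>f. {s. simple_function M s \<and> s \<le> f}"
  have "c * (SUP s\<in>?S f. integral\<^sup>S M s) = (SUP s\<in>?S f. c * integral\<^sup>S M s)"
    by (rule SUP_mult_left_ennreal)
  also have "\<dots> \<le> (SUP r\<in>?S (\<lambda>x. c * f x). integral\<^sup>S M r)"
  proof (intro SUP_least)
    fix s assume s: "s \<in> ?S f"
    have "(\<lambda>x. c * s x) \<in> ?S (\<lambda>x. c * f x)"
      using s by (auto simp: le_fun_def intro!: mult_left_mono)
    moreover have "c * integral\<^sup>S M s = integral\<^sup>S M (\<lambda>x. c * s x)"
      using s by simp
    ultimately show "c * integral\<^sup>S M s \<le> (SUP r\<in>?S (\<lambda>x. c * f x). integral\<^sup>S M r)"
      by (metis (no_types, lifting) SUP_upper)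
  qed
  finally show ?thesis by (simp add: nn_integral_def)
qed

lemma curve_integral_lincomb:
  "a * curve_integral \<gamma> g + b * curve_integral \<gamma> h \<le> curve_integral \<gamma> (\<lambda>x. a * g x + b * h x)"
proof -
  let ?I = "\<lambda>s. indicator {0..enn2real (curve_length \<gamma> 0 1)} s :: ennreal"
  let ?g = "\<lambda>s. g (arclength_param \<gamma> s) * ?I s" and ?h = "\<lambda>s. h (arclength_param \<gamma> s) * ?I s"
  have "a * curve_integral \<gamma> g + b * curve_integral \<gamma> h
      \<le> (\<integral>\<^sup>+s. a * ?g s \<partial>lborel) + (\<integral>\<^sup>+s. b * ?h s \<partial>lborel)"
    unfolding curve_integral_def by (intro add_mono nn_integral_cmult_ge)
  also have "\<dots> \<le> (\<integral>\<^sup>+s. a * ?g s + b * ?h s \<partial>lborel)" by (rule nn_integral_superadditive)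
  also have "\<dots> = curve_integral \<gamma> (\<lambda>x. a * g x + b * h x)"
    unfolding curve_integral_def by (intro nn_integral_cong) (simp add: algebra_simps)
  finally show ?thesis .
qed

locale borel_measure_space = finite_measure M for M :: "'a::metric_space measure" +
  assumes borel_sets: "sets (restrict_space borel (space M)) \<subseteq> sets M"
begin

lemma borel_imp_measurable:
  assumes "g \<in> borel_measurable (restrict_space borel (space M))"
  shows "g \<in> borel_measurable M"
proof (rule measurableI)
  fix A :: "'b set" assume "A \<in> sets borel"
  from measurable_sets[OF assms this] borel_sets show "g -` A \<inter> space M \<in> sets M"
    by (auto simp: space_restrict_space)
qed simp

lemma ball_sets: "ball x r \<inter> space M \<in> sets M"
proof -
  have "ball x r \<inter> space M \<in> sets (restrict_space borel (space M))"
    by (auto simp: sets_restrict_space)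
  then show ?thesis using borel_sets by blast
qed

end

lemma exceptional_family_empty: "exceptional_family p M {}"
  unfolding exceptional_family_def by (intro exI[of _ "\<lambda>_. 0"]) (simp add: enn_Lp_norm_def)

context borel_measure_space
begin

lemma exceptional_family_Un:
  assumes "0 < p" "exceptional_family p M \<Gamma>" "exceptional_family p M \<Delta>"
  shows "exceptional_family p M (\<Gamma> \<union> \<Delta>)"
proof -
  obtain \<rho> \<sigma> where m: "\<rho> \<in> borel_measurable (restrict_space borel (space M))"
      "\<sigma> \<in> borel_measurable (restrict_space borel (space M))"
    and f: "enn_Lp_norm p M \<rho> < \<infinity>" "enn_Lp_norm p M \<sigma> < \<infinity>"
    and i: "\<forall>\<gamma>\<in>\<Gamma>. curve_integral \<gamma> \<rho> = \<infinity>" "\<forall>\<gamma>\<in>\<Delta>. curve_integral \<gamma> \<sigma> = \<infinity>"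
    using assms(2,3) unfolding exceptional_family_def by auto
  let ?r = "\<lambda>x. ennreal 1 * \<rho> x + ennreal 1 * \<sigma> x"
  have "?r \<in> borel_measurable (restrict_space borel (space M))" using m by measurable
  moreover have "enn_Lp_norm p M ?r < \<infinity>"
    by (intro enn_Lp_norm_lincomb_finite borel_imp_measurable m assms f)
  moreover have "curve_integral \<gamma> ?r = \<infinity>" if "\<gamma> \<in> \<Gamma> \<union> \<Delta>" for \<gamma>
    using curve_integral_lincomb[of "ennreal 1" \<gamma> \<rho> "ennreal 1" \<sigma>] that i
    by (auto simp: top_unique)
  ultimately show ?thesis unfolding exceptional_family_def by blast
qed

lemma weak_upper_gradient_const: "weak_upper_gradient p M (\<lambda>_. c) (\<lambda>_. 0)"
  unfolding weak_upper_gradient_def using exceptional_family_empty by auto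

lemma weak_upper_gradient_lincomb:
  assumes "0 < p" "weak_upper_gradient p M u g" "weak_upper_gradient p M v h"
  shows "weak_upper_gradient p M (\<lambda>x. a * u x + b * v x) (\<lambda>x. ennreal \<bar>a\<bar> * g x + ennreal \<bar>b\<bar> * h x)"
proof -
  obtain \<Gamma> where G: "exceptional_family p M \<Gamma>"
      "\<And>\<gamma>. rectifiable_curve (space M) \<gamma> \<Longrightarrow> \<gamma> \<notin> \<Gamma> \<Longrightarrow>
         ennreal \<bar>u (pathfinish \<gamma>) - u (pathstart \<gamma>)\<bar> \<le> curve_integral \<gamma> g"
    using assms(2) unfolding weak_upper_gradient_def by auto
  obtain \<Delta> where D: "exceptional_family p M \<Delta>"
      "\<And>\<gamma>. rectifiable_curve (space M) \<gamma> \<Longrightarrow> \<gamma> \<notin> \<Delta> \<Longrightarrow>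
         ennreal \<bar>v (pathfinish \<gamma>) - v (pathstart \<gamma>)\<bar> \<le> curve_integral \<gamma> h"
    using assms(3) unfolding weak_upper_gradient_def by auto
  have m: "g \<in> borel_measurable (restrict_space borel (space M))"
    "h \<in> borel_measurable (restrict_space borel (space M))"
    using assms unfolding weak_upper_gradient_def by auto
  have "ennreal \<bar>(a * u y + b * v y) - (a * u x + b * v x)\<bar>
      \<le> curve_integral \<gamma> (\<lambda>x. ennreal \<bar>a\<bar> * g x + ennreal \<bar>b\<bar> * h x)"
    if "rectifiable_curve (space M) \<gamma>" "\<gamma> \<notin> \<Gamma> \<union> \<Delta>" "y = pathfinish \<gamma>" "x = pathstart \<gamma>" for \<gamma> x y
  proof -
    have "\<bar>(a * u y + b * v y) - (a * u x + b * v x)\<bar> = \<bar>a * (u y - u x) + b * (v y - v x)\<bar>"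
      by (simp add: algebra_simps)
    also have "\<dots> \<le> \<bar>a\<bar> * \<bar>u y - u x\<bar> + \<bar>b\<bar> * \<bar>v y - v x\<bar>"
      using abs_triangle_ineq[of "a * (u y - u x)" "b * (v y - v x)"] by (simp add: abs_mult)
    finally have "ennreal \<bar>(a * u y + b * v y) - (a * u x + b * v x)\<bar>
        \<le> ennreal \<bar>a\<bar> * ennreal \<bar>u y - u x\<bar> + ennreal \<bar>b\<bar> * ennreal \<bar>v y - v x\<bar>"
      by (simp add: ennreal_leI flip: ennreal_mult ennreal_plus)
    also have "\<dots> \<le> ennreal \<bar>a\<bar> * curve_integral \<gamma> g + ennreal \<bar>b\<bar> * curve_integral \<gamma> h"
      using G(2) D(2) that by (intro add_mono mult_left_mono) auto
    also have "\<dots> \<le> curve_integral \<gamma> (\<lambda>x. ennreal \<bar>a\<bar> * g x + ennreal \<bar>b\<bar> * h x)"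
      by (rule curve_integral_lincomb)
    finally show ?thesis .
  qed
  then show ?thesis
    using exceptional_family_Un[OF assms(1) G(1) D(1)] m unfolding weak_upper_gradient_def
    by (intro conjI exI[of _ "\<Gamma> \<union> \<Delta>"] allI impI) auto
qed

section \<open>The Newtonian space\<close>

lemma newton_space_const:
  assumes "0 < p"
  shows "(\<lambda>_. c) \<in> newton_space p M"
proof -
  have "enn_Lp_norm p M (\<lambda>_. ennreal \<bar>c\<bar>) < \<infinity>" unfolding enn_Lp_norm_finite_iff
    by (simp add: enn_powr_ennreal ennreal_mult_eq_top_iff less_top[symmetric])
  moreover have "enn_Lp_norm p M (\<lambda>_. 0) < \<infinity>" by (simp add: enn_Lp_norm_def)
  ultimately show ?thesis using weak_upper_gradient_const[of p c] unfolding newton_space_def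
    by (intro CollectI conjI exI[of _ "\<lambda>_. 0"]) auto
qed

lemma newton_space_lincomb:
  assumes "0 < p" "u \<in> newton_space p M" "v \<in> newton_space p M"
  shows "(\<lambda>x. a * u x + b * v x) \<in> newton_space p M"
proof -
  have [measurable]: "u \<in> borel_measurable M" "v \<in> borel_measurable M"
    using assms by (auto simp: newton_space_def)
  have "enn_Lp_norm p M (\<lambda>x. ennreal \<bar>a * u x + b * v x\<bar>)
      \<le> enn_Lp_norm p M (\<lambda>x. ennreal \<bar>a\<bar> * ennreal \<bar>u x\<bar> + ennreal \<bar>b\<bar> * ennreal \<bar>v x\<bar>)"
    unfolding enn_Lp_norm_def
    using assms(1) abs_triangle_ineq[of "a * u _" "b * v _"]
    by (intro enn_powr_mono nn_integral_mono)
      (auto simp: ennreal_leI abs_mult simp flip: ennreal_mult ennreal_plus)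
  also have "\<dots> < \<infinity>"
    using assms by (intro enn_Lp_norm_lincomb_finite) (auto simp: newton_space_def)
  finally have "enn_Lp_norm p M (\<lambda>x. ennreal \<bar>a * u x + b * v x\<bar>) < \<infinity>" .
  moreover obtain g h where gh: "weak_upper_gradient p M u g" "enn_Lp_norm p M g < \<infinity>"
      "weak_upper_gradient p M v h" "enn_Lp_norm p M h < \<infinity>"
    using assms by (auto simp: newton_space_def)
  moreover have "enn_Lp_norm p M (\<lambda>x. ennreal \<bar>a\<bar> * g x + ennreal \<bar>b\<bar> * h x) < \<infinity>"
    using gh assms(1)
    by (intro enn_Lp_norm_lincomb_finite borel_imp_measurable) (auto simp: weak_upper_gradient_def)
  ultimately show ?thesis
    using weak_upper_gradient_lincomb[OF assms(1) gh(1,3), of a b] unfolding newton_space_def by auto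
qed

lemma newton_space_add: "0 < p \<Longrightarrow> u \<in> newton_space p M \<Longrightarrow> v \<in> newton_space p M \<Longrightarrow>
    (\<lambda>x. u x + v x) \<in> newton_space p M"
  using newton_space_lincomb[of p u v 1 1] by simp

lemma newton_space_diff: "0 < p \<Longrightarrow> u \<in> newton_space p M \<Longrightarrow> v \<in> newton_space p M \<Longrightarrow>
    (\<lambda>x. u x - v x) \<in> newton_space p M"
  using newton_space_lincomb[of p u v 1 "-1"] by simp

lemma newton_space_integrable:
  assumes p: "1 < p" and u: "u \<in> newton_space p M"
  shows "integrable M u"
proof (rule integrableI_bounded)
  show [measurable]: "u \<in> borel_measurable M" using u by (simp add: newton_space_def)
  have le: "t \<le> 1 + t powr p" if "0 \<le> t" for t :: real
  proof (cases "t \<le> 1")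
    case False
    then have "t powr 1 \<le> t powr p" using p by (intro powr_mono) auto
    then show ?thesis using False by simp
  qed (simp add: add_increasing2)
  have "(\<integral>\<^sup>+x. ennreal (norm (u x)) \<partial>M) \<le> (\<integral>\<^sup>+x. 1 + enn_powr (ennreal \<bar>u x\<bar>) p \<partial>M)"
    using le by (intro nn_integral_mono)
      (simp add: enn_powr_ennreal ennreal_leI flip: ennreal_plus ennreal_1)
  also have "\<dots> = emeasure M (space M) + (\<integral>\<^sup>+x. enn_powr (ennreal \<bar>u x\<bar>) p \<partial>M)"
    by (simp add: nn_integral_add)
  also have "\<dots> < \<infinity>"
    using u enn_Lp_norm_finite_iff[of p M "\<lambda>x. ennreal \<bar>u x\<bar>"]
    by (simp add: newton_space_def less_top[symmetric])
  finally show "(\<integral>\<^sup>+x. ennreal (norm (u x)) \<partial>M) < \<infinity>" .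
qed

text \<open>
  The Poincare inequality speaks of upper gradients, while \<open>g\<close> is only a weak one. If \<open>\<rho>\<close> has infinite
  integral along the exceptional curves, then \<open>g + \<epsilon> \<rho>\<close> is an upper gradient for every \<open>\<epsilon> > 0\<close>, with
  p-norm \<open>\<epsilon> \<parallel>\<rho>\<parallel>\<close> because \<open>g = 0\<close> almost everywhere. As the space is bounded, it is a single ball, on
  which the mean oscillation of \<open>u\<close> is thus at most a multiple of every \<open>\<epsilon>\<close>.
\<close>

lemma poincare_zero_gradient_const:
  assumes p: "1 < p" and bd: "bounded (space M)" and pos: "positive_finite_on_balls M"
    and PI: "poincare_inequality p M"
    and u: "u \<in> newton_space p M" and g: "weak_upper_gradient p M u g" "AE x in M. g x = 0"
  shows "\<exists>c. AE x in M. u x = c"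
proof (cases "space M = {}")
  case True
  then show ?thesis by (auto intro!: AE_I2)
next
  case False
  then obtain x0 where x0: "x0 \<in> space M" by auto
  from bd obtain e where e: "\<And>y. y \<in> space M \<Longrightarrow> dist x0 y \<le> e"
    by (meson bounded_any_center[of "space M" x0])
  define r where "r = \<bar>e\<bar> + 1"
  have r: "0 < r" by (simp add: r_def)
  have ball: "ball x0 s \<inter> space M = space M" if "r \<le> s" for s
    using e that by (force simp: r_def)
  obtain C \<Lambda> where C: "0 < C" and L: "1 \<le> \<Lambda>"
    and PI': "\<And>x r u g. x \<in> space M \<Longrightarrow> 0 < r \<Longrightarrow>
      (let B = ball x r \<inter> space M; B' = ball x (\<Lambda> * r) \<inter> space M;
            u\<^sub>B = (LINT y:B|M. u y) / measure M B
        in u \<in> borel_measurable M \<and> set_integrable M B u \<and> upper_gradient (space M) u g \<longrightarrow>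
           (\<integral>\<^sup>+y\<in>B. ennreal \<bar>u y - u\<^sub>B\<bar> \<partial>M) / emeasure M B
             \<le> ennreal (C * r) *
               enn_powr ((\<integral>\<^sup>+y\<in>B'. enn_powr (g y) p \<partial>M) / emeasure M B') (1 / p))"
    using PI unfolding poincare_inequality_def by blast
  have mu[measurable]: "u \<in> borel_measurable M" using u by (simp add: newton_space_def)
  have si: "set_integrable M (space M) u"
    using newton_space_integrable[OF p u] integrable_mult_indicator[OF sets.top, of M u]
    by (simp add: set_integrable_def)
  define m where "m = emeasure M (space M)"
  have m: "0 < m" "m < \<infinity>"
    using pos x0 r ball[of r] unfolding positive_finite_on_balls_def m_def by (metis order_refl)+
  define c where "c = (LINT y:space M|M. u y) / measure M (space M)"
  obtain \<Gamma> where G: "exceptional_family p M \<Gamma>"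
      "\<And>\<gamma>. rectifiable_curve (space M) \<gamma> \<Longrightarrow> \<gamma> \<notin> \<Gamma> \<Longrightarrow>
         ennreal \<bar>u (pathfinish \<gamma>) - u (pathstart \<gamma>)\<bar> \<le> curve_integral \<gamma> g"
    using g unfolding weak_upper_gradient_def by auto
  obtain \<rho> where rho: "\<rho> \<in> borel_measurable (restrict_space borel (space M))"
      "enn_Lp_norm p M \<rho> < \<infinity>" "\<And>\<gamma>. \<gamma> \<in> \<Gamma> \<Longrightarrow> curve_integral \<gamma> \<rho> = \<infinity>"
    using G(1) unfolding exceptional_family_def by auto
  have mg: "g \<in> borel_measurable (restrict_space borel (space M))"
    using g by (simp add: weak_upper_gradient_def)
  note [measurable] = borel_imp_measurable[OF rho(1)] borel_imp_measurable[OF mg]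
  define J where "J = (\<integral>\<^sup>+y. enn_powr (\<rho> y) p \<partial>M)"
  define W where "W = ennreal (C * r) * enn_powr (J / m) (1 / p)"
  have "J / m < \<infinity>"
    using rho(2) m unfolding J_def enn_Lp_norm_finite_iff
    by (auto simp: less_top[symmetric] ennreal_divide_eq_top_iff)
  then have W: "W < \<infinity>" unfolding W_def using enn_powr_finite_iff[of "J / m" "1 / p"]
    by (simp add: ennreal_mult_less_top)
  let ?L = "(\<integral>\<^sup>+y. ennreal \<bar>u y - c\<bar> \<partial>M) / m"
  have le: "?L \<le> ennreal \<epsilon> * W" if eps: "0 < \<epsilon>" for \<epsilon>
  proof -
    let ?h = "\<lambda>x. 1 * g x + ennreal \<epsilon> * \<rho> x"
    have "upper_gradient (space M) u ?h" unfolding upper_gradient_def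
    proof (intro conjI allI impI)
      show "?h \<in> borel_measurable (restrict_space borel (space M))" using mg rho(1) by measurable
    next
      fix \<gamma> assume R: "rectifiable_curve (space M) \<gamma>"
      have "1 * curve_integral \<gamma> g + ennreal \<epsilon> * curve_integral \<gamma> \<rho> \<le> curve_integral \<gamma> ?h"
        by (rule curve_integral_lincomb)
      moreover have "ennreal \<bar>u (pathfinish \<gamma>) - u (pathstart \<gamma>)\<bar>
          \<le> 1 * curve_integral \<gamma> g + ennreal \<epsilon> * curve_integral \<gamma> \<rho>"
      proof (cases "\<gamma> \<in> \<Gamma>")
        case True
        then show ?thesis using eps by (simp add: rho(3) ennreal_mult_top)
      next
        case False
        then show ?thesis using G(2)[OF R] by (simp add: add_increasing2)
      qed
      ultimately show "ennreal \<bar>u (pathfinish \<gamma>) - u (pathstart \<gamma>)\<bar> \<le> curve_integral \<gamma> ?h"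
        by (rule order_trans[rotated])
    qed
    moreover have rL: "r \<le> \<Lambda> * r" using L r by simp
    ultimately have PIh: "(\<integral>\<^sup>+y\<in>space M. ennreal \<bar>u y - c\<bar> \<partial>M) / m
        \<le> ennreal (C * r) * enn_powr ((\<integral>\<^sup>+y\<in>space M. enn_powr (?h y) p \<partial>M) / m) (1 / p)"
      using PI'[OF x0 r, of u ?h] si mu unfolding Let_def ball[OF order_refl] ball[OF rL] m_def c_def
      by blast
    have lhs: "(\<integral>\<^sup>+y\<in>space M. ennreal \<bar>u y - c\<bar> \<partial>M) = (\<integral>\<^sup>+y. ennreal \<bar>u y - c\<bar> \<partial>M)"
      by (intro nn_integral_cong) simp
    have rhs: "(\<integral>\<^sup>+y\<in>space M. enn_powr (?h y) p \<partial>M) = enn_powr (ennreal \<epsilon>) p * J"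
    proof -
      have "(\<integral>\<^sup>+y\<in>space M. enn_powr (?h y) p \<partial>M)
          = (\<integral>\<^sup>+y. enn_powr (ennreal \<epsilon>) p * enn_powr (\<rho> y) p \<partial>M)"
      proof (rule nn_integral_cong_AE)
        show "AE y in M. enn_powr (?h y) p * indicator (space M) y
            = enn_powr (ennreal \<epsilon>) p * enn_powr (\<rho> y) p"
          using g(2) AE_space by eventually_elim (simp add: enn_powr_mult)
      qed
      then show ?thesis by (simp add: J_def nn_integral_cmult)
    qed
    have "enn_powr (ennreal \<epsilon>) p * J / m = ennreal (\<epsilon> powr p) * (J / m)"
      using eps by (simp add: enn_powr_ennreal ennreal_times_divide)
    then have pow: "enn_powr (enn_powr (ennreal \<epsilon>) p * J / m) (1 / p)
        = ennreal \<epsilon> * enn_powr (J / m) (1 / p)"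
      using eps p by (simp only: enn_powr_mult) (simp add: enn_powr_ennreal powr_powr)
    show ?thesis using PIh unfolding lhs rhs pow W_def by (subst mult.left_commute)
  qed
  have "?L \<le> 0"
  proof (rule ennreal_le_epsilon)
    fix e :: real assume e: "0 < e"
    obtain w where w: "W = ennreal w" "0 \<le> w" using W by (cases W) auto
    have "?L \<le> ennreal (e / (w + 1)) * ennreal w" using le[of "e / (w + 1)"] e w by simp
    also have "\<dots> = ennreal (e / (w + 1) * w)" using e w by (simp flip: ennreal_mult)
    also have "\<dots> \<le> ennreal e" using e w by (intro ennreal_leI) (simp add: field_simps)
    finally show "?L \<le> 0 + ennreal e" by simp
  qed
  then have "(\<integral>\<^sup>+y. ennreal \<bar>u y - c\<bar> \<partial>M) = 0"
    using m by (auto simp: ennreal_divide_eq_0_iff)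
  then have "AE y in M. u y = c" by (simp add: nn_integral_0_iff_AE)
  then show ?thesis by blast
qed

section \<open>Traces\<close>

lemma ennreal_divide_lincomb_mono:
  fixes x a b y z m :: ennreal
  assumes "x \<le> a * y + b * z"
  shows "x / m \<le> a * (y / m) + b * (z / m)"
  using divide_right_mono_ennreal[OF assms, of m]
  by (simp add: add_divide_distrib_ennreal ennreal_times_divide)

lemma has_trace_const: "has_trace M \<nu> (\<lambda>_. c) (\<lambda>_. c)"
  by (simp add: has_trace_def)

lemma has_trace_lincomb:
  assumes [measurable]: "u \<in> borel_measurable M" "v \<in> borel_measurable M"
    and tr: "has_trace M \<nu> u f" "has_trace M \<nu> v g"
  shows "has_trace M \<nu> (\<lambda>x. a * u x + b * v x) (\<lambda>x. a * f x + b * g x)"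
  using tr unfolding has_trace_def
proof eventually_elim
  case (elim \<xi>)
  let ?B = "\<lambda>r. ball \<xi> r \<inter> space M"
  let ?q = "\<lambda>u f r. (\<integral>\<^sup>+x\<in>?B r. ennreal \<bar>u x - f \<xi>\<bar> \<partial>M) / emeasure M (?B r)"
  have le: "?q (\<lambda>x. a * u x + b * v x) (\<lambda>x. a * f x + b * g x) r
      \<le> ennreal \<bar>a\<bar> * ?q u f r + ennreal \<bar>b\<bar> * ?q v g r" for r
  proof -
    note ball_sets[of \<xi> r, measurable]
    have "(\<integral>\<^sup>+x\<in>?B r. ennreal \<bar>a * u x + b * v x - (a * f \<xi> + b * g \<xi>)\<bar> \<partial>M)
        \<le> (\<integral>\<^sup>+x. ennreal \<bar>a\<bar> * (ennreal \<bar>u x - f \<xi>\<bar> * indicator (?B r) x)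
               + ennreal \<bar>b\<bar> * (ennreal \<bar>v x - g \<xi>\<bar> * indicator (?B r) x) \<partial>M)"
    proof (intro nn_integral_mono)
      fix x
      have "\<bar>a * u x + b * v x - (a * f \<xi> + b * g \<xi>)\<bar> = \<bar>a * (u x - f \<xi>) + b * (v x - g \<xi>)\<bar>"
        by (simp add: algebra_simps)
      also have "\<dots> \<le> \<bar>a\<bar> * \<bar>u x - f \<xi>\<bar> + \<bar>b\<bar> * \<bar>v x - g \<xi>\<bar>"
        using abs_triangle_ineq[of "a * (u x - f \<xi>)" "b * (v x - g \<xi>)"] by (simp add: abs_mult)
      finally show "ennreal \<bar>a * u x + b * v x - (a * f \<xi> + b * g \<xi>)\<bar> * indicator (?B r) x
        \<le> ennreal \<bar>a\<bar> * (ennreal \<bar>u x - f \<xi>\<bar> * indicator (?B r) x)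
               + ennreal \<bar>b\<bar> * (ennreal \<bar>v x - g \<xi>\<bar> * indicator (?B r) x)"
        by (auto simp: indicator_def ennreal_leI simp flip: ennreal_mult ennreal_plus)
    qed
    also have "\<dots> = ennreal \<bar>a\<bar> * (\<integral>\<^sup>+x\<in>?B r. ennreal \<bar>u x - f \<xi>\<bar> \<partial>M)
        + ennreal \<bar>b\<bar> * (\<integral>\<^sup>+x\<in>?B r. ennreal \<bar>v x - g \<xi>\<bar> \<partial>M)"
      by (simp add: nn_integral_add nn_integral_cmult)
    finally show ?thesis by (rule ennreal_divide_lincomb_mono)
  qed
  have "((\<lambda>r. ennreal \<bar>a\<bar> * ?q u f r + ennreal \<bar>b\<bar> * ?q v g r)
      \<longlongrightarrow> ennreal \<bar>a\<bar> * 0 + ennreal \<bar>b\<bar> * 0) (at_right 0)"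
    by (intro tendsto_add ennreal_tendsto_cmult elim) auto
  then have "((\<lambda>r. ennreal \<bar>a\<bar> * ?q u f r + ennreal \<bar>b\<bar> * ?q v g r) \<longlongrightarrow> 0) (at_right 0)" by simp
  from tendsto_sandwich[OF _ _ tendsto_const this, of "?q (\<lambda>x. a * u x + b * v x) (\<lambda>x. a * f x + b * g x)"] le
  show ?case by simp
qed

lemma has_trace_AE_cong:
  assumes tr: "has_trace M \<nu> u f" and u: "AE x in M. u x = u' x" and f: "AE x in \<nu>. f x = f' x"
  shows "has_trace M \<nu> u' f'"
  using tr f unfolding has_trace_def
proof eventually_elim
  case (elim \<xi>)
  have "(\<integral>\<^sup>+x\<in>ball \<xi> r \<inter> space M. ennreal \<bar>u' x - f' \<xi>\<bar> \<partial>M)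
      = (\<integral>\<^sup>+x\<in>ball \<xi> r \<inter> space M. ennreal \<bar>u x - f \<xi>\<bar> \<partial>M)" for r
    by (rule nn_integral_cong_AE) (use u in eventually_elim, simp add: elim)
  with elim show ?case by simp
qed

end

section \<open>Separability of doubling spaces\<close>

text \<open>
  Iterating the doubling condition bounds the mass of all balls of radius \<open>e / 2\<close> below by one constant
  \<open>c > 0\<close>. Around the points of an \<open>e\<close>-separated set these balls are disjoint, so such a set has at most
  \<open>\<mu>(\<Omega>) / c\<close> points; one with the largest number of points is a net.
\<close>

lemma (in borel_measure_space) doubling_finite_net:
  assumes bd: "bounded (space M)" and pos: "positive_finite_on_balls M" and db: "doubling_measure M"
    and e: "0 < e"
  shows "\<exists>F. finite F \<and> F \<subseteq> space M \<and> (\<forall>x\<in>space M. \<exists>y\<in>F. dist x y < e)"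
proof (cases "space M = {}")
  case True
  then show ?thesis by (intro exI[of _ "{}"]) auto
next
  case False
  obtain R where R: "\<And>x y. x \<in> space M \<Longrightarrow> y \<in> space M \<Longrightarrow> dist x y \<le> R"
    using bd unfolding bounded_two_points by blast
  obtain C where C: "0 < C"
    and "\<And>x r. x \<in> space M \<Longrightarrow> 0 < r \<Longrightarrow>
      emeasure M (ball x (2 * r) \<inter> space M) \<le> ennreal C * emeasure M (ball x r \<inter> space M)"
    using db unfolding doubling_measure_def by blast
  then have dbl: "measure M (ball x (2 * r) \<inter> space M) \<le> C * measure M (ball x r \<inter> space M)"
    if "x \<in> space M" "0 < r" for x r
    using that C by (simp add: emeasure_eq_measure flip: ennreal_mult)
  have iter: "measure M (ball x (2 ^ k * r) \<inter> space M) \<le> C ^ k * measure M (ball x r \<inter> space M)"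
    if "x \<in> space M" "0 < r" for x r k
  proof (induction k)
    case (Suc k)
    have "measure M (ball x (2 ^ Suc k * r) \<inter> space M) \<le> C * measure M (ball x (2 ^ k * r) \<inter> space M)"
      using dbl[OF that(1), of "2 ^ k * r"] that(2) by (simp add: mult.assoc)
    also have "\<dots> \<le> C * (C ^ k * measure M (ball x r \<inter> space M))"
      using C Suc by (intro mult_left_mono) auto
    finally show ?case by (simp add: mult.assoc)
  qed simp
  \<comment> \<open>After \<open>k\<close> doublings a ball of radius \<open>e / 2\<close> covers the whole space.\<close>
  obtain k :: nat where k: "R / (e / 2) < 2 ^ k" using real_arch_pow[of 2 "R / (e / 2)"] by auto
  then have big: "R < 2 ^ k * (e / 2)" using e by (simp add: field_simps)
  define m where "m = measure M (space M)"
  define c where "c = m / C ^ k"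
  have m: "0 < m"
  proof -
    from False obtain x where "x \<in> space M" by auto
    then have "0 < emeasure M (ball x e \<inter> space M)"
      using pos e by (simp add: positive_finite_on_balls_def)
    also have "\<dots> \<le> emeasure M (space M)" by (intro emeasure_mono) auto
    finally show ?thesis by (simp add: m_def emeasure_eq_measure)
  qed
  then have c: "0 < c" using C by (simp add: c_def)
  have lower: "c \<le> measure M (ball x (e / 2) \<inter> space M)" if x: "x \<in> space M" for x
  proof -
    have "ball x (2 ^ k * (e / 2)) \<inter> space M = space M" using R[OF x] big by force
    then have "m \<le> C ^ k * measure M (ball x (e / 2) \<inter> space M)"
      using iter[OF x, of "e / 2" k] e by (simp add: m_def)
    then show ?thesis using C by (simp add: c_def field_simps)
  qed
  define sep where "sep F \<longleftrightarrow> finite F \<and> F \<subseteq> space M \<and> (\<forall>x\<in>F. \<forall>y\<in>F. x \<noteq> y \<longrightarrow> e \<le> dist x y)" for F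
  have bound: "card F \<le> nat \<lceil>m / c\<rceil>" if F: "sep F" for F
  proof -
    have disj: "disjoint_family_on (\<lambda>x. ball x (e / 2) \<inter> space M) F"
      unfolding disjoint_family_on_def
    proof (intro ballI impI)
      fix x y assume "x \<in> F" "y \<in> F" "x \<noteq> y"
      then have "e \<le> dist x y" using F by (simp add: sep_def)
      then show "(ball x (e / 2) \<inter> space M) \<inter> (ball y (e / 2) \<inter> space M) = {}"
        using dist_triangle_half_r[of _ x e y] by (auto simp: dist_commute)
    qed
    have "real (card F) * c \<le> (\<Sum>x\<in>F. measure M (ball x (e / 2) \<inter> space M))"
      using F lower by (intro sum_bounded_below) (auto simp: sep_def)
    also have "\<dots> = measure M (\<Union>x\<in>F. ball x (e / 2) \<inter> space M)"
      using F disj ball_sets by (intro finite_measure_finite_Union[symmetric]) (auto simp: sep_def)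
    also have "\<dots> \<le> m" unfolding m_def by (rule bounded_measure)
    finally have "real (card F) \<le> m / c" using c by (simp add: field_simps)
    then show ?thesis by linarith
  qed
  have "sep {}" by (simp add: sep_def)
  then obtain F where F: "sep F" and max: "\<And>F'. sep F' \<Longrightarrow> card F' \<le> card F"
    using ex_has_greatest_nat[of sep "{}" card "nat \<lceil>m / c\<rceil> + 1"] bound by (metis less_Suc_eq_le Suc_eq_plus1)
  have "\<exists>y\<in>F. dist x y < e" if x: "x \<in> space M" for x
  proof (rule ccontr)
    assume "\<not> ?thesis"
    then have far: "\<forall>y\<in>F. e \<le> dist x y" by (auto simp: not_less)
    then have "x \<notin> F" using e by force
    moreover have "sep (insert x F)" using F far x by (auto simp: sep_def dist_commute)
    ultimately show False using max[of "insert x F"] F by (simp add: sep_def)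
  qed
  then show ?thesis using F by (auto simp: sep_def)
qed

lemma (in borel_measure_space) doubling_separable:
  assumes "bounded (space M)" "positive_finite_on_balls M" "doubling_measure M"
  shows "\<exists>D. countable D \<and> closure (space M) \<subseteq> closure D"
proof -
  have "\<forall>n::nat. \<exists>F. finite F \<and> F \<subseteq> space M \<and> (\<forall>x\<in>space M. \<exists>y\<in>F. dist x y < 1 / real (Suc n))"
    using doubling_finite_net[OF assms] by simp
  then obtain F where F: "\<And>n. finite (F n)"
      "\<And>n x. x \<in> space M \<Longrightarrow> \<exists>y\<in>F n. dist x y < 1 / real (Suc n)"
    by metis
  have "space M \<subseteq> closure (\<Union>n. F n)"
  proof
    fix x assume x: "x \<in> space M"
    show "x \<in> closure (\<Union>n. F n)" unfolding closure_approachable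
    proof (intro allI impI)
      fix e :: real assume "0 < e"
      then obtain n where n: "1 / real (Suc n) < e" using nat_approx_posE by blast
      obtain y where "y \<in> F n" "dist x y < 1 / real (Suc n)" using F(2)[OF x] by blast
      then show "\<exists>y\<in>\<Union>n. F n. dist y x < e" using n by (auto simp: dist_commute intro!: bexI[of _ y])
    qed
  qed
  then have "closure (space M) \<subseteq> closure (\<Union>n. F n)" by (rule closure_minimal) simp
  moreover have "countable (\<Union>n. F n)" using F(1) by (auto intro: countable_finite)
  ultimately show ?thesis by blast
qed

section \<open>The Besov space is a vector space\<close>

definition besov_kernel :: "real \<Rightarrow> real \<Rightarrow> 'a::metric_space measure \<Rightarrow> ('a \<Rightarrow> real) \<Rightarrow> 'a \<Rightarrow> 'a \<Rightarrow> ennreal" where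
  "besov_kernel p \<theta> N f y x = ennreal (\<bar>f y - f x\<bar> powr p)
     / (ennreal (dist y x powr (\<theta> * p)) * emeasure N (ball y (dist y x) \<inter> space N))"

definition besov_energy :: "real \<Rightarrow> real \<Rightarrow> 'a::metric_space measure \<Rightarrow> ('a \<Rightarrow> real) \<Rightarrow> ennreal" where
  "besov_energy p \<theta> N f = (\<integral>\<^sup>+y. (\<integral>\<^sup>+x. besov_kernel p \<theta> N f y x \<partial>N) \<partial>N)"

lemma besov_norm_eq: "besov_norm p \<theta> N f = enn_powr (besov_energy p \<theta> N f) (1 / p)"
  by (simp add: besov_norm_def besov_energy_def besov_kernel_def)

lemma besov_norm_add_const: "besov_norm p \<theta> N (\<lambda>x. f x + c) = besov_norm p \<theta> N f"
  by (simp add: besov_norm_def)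

lemma besov_space_add_const: "f \<in> besov_space p \<theta> N \<Longrightarrow> (\<lambda>x. f x + c) \<in> besov_space p \<theta> N"
  by (auto simp: besov_space_def besov_norm_add_const intro: borel_measurable_add)

context borel_measure_space
begin

lemma measurable_dist_const: "(\<lambda>x. dist x q) \<in> borel_measurable M"
  by (intro borel_imp_measurable measurable_restrict_space1 borel_measurable_continuous_onI)
    (intro continuous_intros)

text \<open>
  The product \<open>\<sigma>\<close>-algebra sees only functions of one variable. Separability expresses the distance
  through countably many of them: \<open>d(x, y) < a\<close> iff \<open>d(x, q) + d(y, q) < a\<close> for some \<open>q\<close> in the dense set.
\<close>

lemma measurable_dist_Pair:
  assumes D: "countable D" "space M \<subseteq> closure D"
  shows "(\<lambda>w. dist (fst w) (snd w)) \<in> borel_measurable (M \<Otimes>\<^sub>M M)"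
proof (rule borel_measurable_iff_less[THEN iffD2, rule_format])
  fix a :: real
  have eq: "{w \<in> space (M \<Otimes>\<^sub>M M). dist (fst w) (snd w) < a}
      = (\<Union>q\<in>D. {w \<in> space (M \<Otimes>\<^sub>M M). dist (fst w) q + dist (snd w) q < a})" (is "?L = ?R")
  proof (intro equalityI subsetI)
    fix w assume w: "w \<in> ?L"
    obtain x y where xy: "w = (x, y)" by force
    have "x \<in> closure D" "0 < (a - dist x y) / 2" using w D xy by (auto simp: space_pair_measure)
    then obtain q where q: "q \<in> D" "dist q x < (a - dist x y) / 2"
      unfolding closure_approachable by blast
    have "dist y q \<le> dist x y + dist q x" using dist_triangle[of y q x] by (simp add: dist_commute)
    then have "dist x q + dist y q < a" using q by (simp add: dist_commute field_simps)
    then show "w \<in> ?R" using q w xy by auto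
  next
    fix w assume "w \<in> ?R"
    then obtain q where "w \<in> space (M \<Otimes>\<^sub>M M)" "dist (fst w) q + dist (snd w) q < a" by auto
    then show "w \<in> ?L" using dist_triangle[of "fst w" "snd w" q] by (auto simp: dist_commute)
  qed
  note measurable_dist_const[measurable]
  show "?L \<in> sets (M \<Otimes>\<^sub>M M)" unfolding eq
    by (intro sets.countable_UN'' D) measurable
qed

text \<open>
  The measure of the ball is the measure of a section of the set \<open>{((y, x), z). d(y, z) < d(y, x)}\<close>.
\<close>

lemma measurable_besov_kernel:
  assumes D: "countable D" "space M \<subseteq> closure D" and [measurable]: "f \<in> borel_measurable M"
  shows "case_prod (besov_kernel p \<theta> M f) \<in> borel_measurable (M \<Otimes>\<^sub>M M)"
proof -
  note d[measurable] = measurable_dist_Pair[OF D]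
  \<comment> \<open>A point \<open>w\<close> of the triple product is \<open>((y, x), z)\<close>.\<close>
  let ?Q = "{w \<in> space ((M \<Otimes>\<^sub>M M) \<Otimes>\<^sub>M M). dist (fst (fst w)) (snd w) < dist (fst (fst w)) (snd (fst w))}"
  have "(\<lambda>w. (fst (fst w), snd w)) \<in> (M \<Otimes>\<^sub>M M) \<Otimes>\<^sub>M M \<rightarrow>\<^sub>M M \<Otimes>\<^sub>M M" by measurable
  from measurable_compose[OF this d]
  have [measurable]: "(\<lambda>w. dist (fst (fst w)) (snd w)) \<in> borel_measurable ((M \<Otimes>\<^sub>M M) \<Otimes>\<^sub>M M)" by simp
  have [measurable]: "(\<lambda>w. dist (fst (fst w)) (snd (fst w))) \<in> borel_measurable ((M \<Otimes>\<^sub>M M) \<Otimes>\<^sub>M M)"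
    using measurable_compose[OF measurable_fst d] by simp
  have "?Q \<in> sets ((M \<Otimes>\<^sub>M M) \<Otimes>\<^sub>M M)" by measurable
  from measurable_emeasure_Pair[OF this]
  have "(\<lambda>w. emeasure M (Pair w -` ?Q)) \<in> borel_measurable (M \<Otimes>\<^sub>M M)" .
  moreover have "Pair w -` ?Q = ball (fst w) (dist (fst w) (snd w)) \<inter> space M"
    if "w \<in> space (M \<Otimes>\<^sub>M M)" for w
    using that by (auto simp: space_pair_measure)
  ultimately have [measurable]:
    "(\<lambda>w. emeasure M (ball (fst w) (dist (fst w) (snd w)) \<inter> space M)) \<in> borel_measurable (M \<Otimes>\<^sub>M M)"
    by (simp cong: measurable_cong)
  show ?thesis unfolding besov_kernel_def case_prod_beta by measurable
qed

lemma besov_energy_lincomb: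
  assumes p: "0 < p" and D: "countable D" "space M \<subseteq> closure D"
    and m[measurable]: "f \<in> borel_measurable M" "g \<in> borel_measurable M"
  shows "besov_energy p \<theta> M (\<lambda>x. a * f x + b * g x)
      \<le> ennreal (2 powr p * \<bar>a\<bar> powr p) * besov_energy p \<theta> M f
        + ennreal (2 powr p * \<bar>b\<bar> powr p) * besov_energy p \<theta> M g"
proof -
  let ?K = "besov_kernel p \<theta> M"
  let ?A = "ennreal (2 powr p * \<bar>a\<bar> powr p)" and ?B = "ennreal (2 powr p * \<bar>b\<bar> powr p)"
  have le: "?K (\<lambda>x. a * f x + b * g x) y x \<le> ?A * ?K f y x + ?B * ?K g y x" for x y
  proof -
    have "\<bar>(a * f y + b * g y) - (a * f x + b * g x)\<bar> = \<bar>a * (f y - f x) + b * (g y - g x)\<bar>"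
      by (simp add: algebra_simps)
    also have "\<dots> \<le> \<bar>a\<bar> * \<bar>f y - f x\<bar> + \<bar>b\<bar> * \<bar>g y - g x\<bar>"
      using abs_triangle_ineq[of "a * (f y - f x)" "b * (g y - g x)"] by (simp add: abs_mult)
    finally have "\<bar>(a * f y + b * g y) - (a * f x + b * g x)\<bar> powr p
        \<le> (\<bar>a\<bar> * \<bar>f y - f x\<bar> + \<bar>b\<bar> * \<bar>g y - g x\<bar>) powr p"
      using p by (intro powr_mono2) auto
    also have "\<dots> \<le> 2 powr p * ((\<bar>a\<bar> * \<bar>f y - f x\<bar>) powr p + (\<bar>b\<bar> * \<bar>g y - g x\<bar>) powr p)"
      using p by (intro powr_add_le) auto
    also have "\<dots> = 2 powr p * \<bar>a\<bar> powr p * \<bar>f y - f x\<bar> powr p + 2 powr p * \<bar>b\<bar> powr p * \<bar>g y - g x\<bar> powr p"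
      by (simp add: powr_mult algebra_simps)
    finally have "ennreal (\<bar>(a * f y + b * g y) - (a * f x + b * g x)\<bar> powr p)
        \<le> ?A * ennreal (\<bar>f y - f x\<bar> powr p) + ?B * ennreal (\<bar>g y - g x\<bar> powr p)"
      by (simp add: ennreal_leI flip: ennreal_mult ennreal_plus)
    then show ?thesis unfolding besov_kernel_def by (rule ennreal_divide_lincomb_mono)
  qed
  note k[measurable] = measurable_besov_kernel[OF D m(1), of p \<theta>] measurable_besov_kernel[OF D m(2), of p \<theta>]
  note [measurable] = borel_measurable_nn_integral[OF k(1)] borel_measurable_nn_integral[OF k(2)]
  have s: "?K f y \<in> borel_measurable M" "?K g y \<in> borel_measurable M" if "y \<in> space M" for y
    using measurable_Pair2[OF k(1) that] measurable_Pair2[OF k(2) that] by simp_all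
  have "besov_energy p \<theta> M (\<lambda>x. a * f x + b * g x)
      \<le> (\<integral>\<^sup>+y. (\<integral>\<^sup>+x. ?A * ?K f y x + ?B * ?K g y x \<partial>M) \<partial>M)"
    unfolding besov_energy_def by (intro nn_integral_mono le)
  also have "\<dots> = (\<integral>\<^sup>+y. ?A * (\<integral>\<^sup>+x. ?K f y x \<partial>M) + ?B * (\<integral>\<^sup>+x. ?K g y x \<partial>M) \<partial>M)"
    by (intro nn_integral_cong) (simp add: nn_integral_add nn_integral_cmult s)
  also have "\<dots> = ?A * besov_energy p \<theta> M f + ?B * besov_energy p \<theta> M g"
    unfolding besov_energy_def by (simp add: nn_integral_add nn_integral_cmult)
  finally show ?thesis .
qed

lemma besov_space_lincomb:
  assumes p: "0 < p" and D: "countable D" "space M \<subseteq> closure D"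
    and f: "f \<in> besov_space p \<theta> M" and g: "g \<in> besov_space p \<theta> M"
  shows "(\<lambda>x. a * f x + b * g x) \<in> besov_space p \<theta> M"
proof -
  have m: "f \<in> borel_measurable M" "g \<in> borel_measurable M" using f g by (auto simp: besov_space_def)
  have fin: "besov_energy p \<theta> M f < \<infinity>" "besov_energy p \<theta> M g < \<infinity>"
    using f g unfolding besov_space_def besov_norm_eq enn_powr_finite_iff by auto
  note besov_energy_lincomb[OF p D m, of \<theta> a b]
  also have "ennreal (2 powr p * \<bar>a\<bar> powr p) * besov_energy p \<theta> M f
        + ennreal (2 powr p * \<bar>b\<bar> powr p) * besov_energy p \<theta> M g < \<infinity>"
    using fin by (simp add: ennreal_mult_less_top)
  finally show ?thesis using m unfolding besov_space_def besov_norm_eq enn_powr_finite_iff by simp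
qed

lemma besov_norm_scale:
  assumes p: "0 < p" and D: "countable D" "space M \<subseteq> closure D"
    and m[measurable]: "f \<in> borel_measurable M"
  shows "besov_norm p \<theta> M (\<lambda>x. a * f x) = ennreal \<bar>a\<bar> * besov_norm p \<theta> M f"
proof -
  let ?K = "besov_kernel p \<theta> M"
  note k[measurable] = measurable_besov_kernel[OF D m, of p \<theta>]
  note [measurable] = borel_measurable_nn_integral[OF k]
  have s: "?K f y \<in> borel_measurable M" if "y \<in> space M" for y
    using measurable_Pair2[OF k that] by simp
  have K: "?K (\<lambda>x. a * f x) y = (\<lambda>x. ennreal (\<bar>a\<bar> powr p) * ?K f y x)" for y
    by (simp add: fun_eq_iff besov_kernel_def abs_mult powr_mult ennreal_mult ennreal_times_divide
        flip: right_diff_distrib)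
  have "besov_energy p \<theta> M (\<lambda>x. a * f x)
      = (\<integral>\<^sup>+y. ennreal (\<bar>a\<bar> powr p) * (\<integral>\<^sup>+x. ?K f y x \<partial>M) \<partial>M)"
    unfolding besov_energy_def by (intro nn_integral_cong) (simp add: K nn_integral_cmult s)
  also have "\<dots> = ennreal (\<bar>a\<bar> powr p) * besov_energy p \<theta> M f"
    unfolding besov_energy_def by (simp add: nn_integral_cmult)
  finally show ?thesis using p by (simp add: besov_norm_eq enn_powr_mult enn_powr_ennreal powr_powr)
qed

end

text \<open>
  The integrand is \<open>0 / 0 = 0\<close> on the diagonal, which is the whole product here.
\<close>

lemma besov_norm_singleton:
  assumes "space N = {\<xi>}"
  shows "besov_norm p \<theta> N f = 0"
proof -
  have "(\<integral>\<^sup>+x. besov_kernel p \<theta> N f y x \<partial>N) = 0" if "y \<in> space N" for y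
    using that assms by (subst nn_integral_cong[where v = "\<lambda>_. 0"]) (auto simp: besov_kernel_def)
  then have "besov_energy p \<theta> N f = 0" unfolding besov_energy_def
    by (subst nn_integral_cong[where v = "\<lambda>_. 0"]) auto
  then show ?thesis by (simp add: besov_norm_eq)
qed

section \<open>Cheeger gradients\<close>

text \<open>
  The interior part of the setting: gradients, energies and the Poincare inequality make sense before
  any boundary measure is given.
\<close>

locale cheeger_space = borel_measure_space M for M :: "'a::metric_space measure" +
  fixes p :: real and S :: "('a, 'n::finite) cheeger"
  assumes exponent: "1 < p"
    and cheeger: "cheeger_structure p M S"
    and bounded_space: "bounded (space M)"
    and pos_balls: "positive_finite_on_balls M"
    and poincare: "poincare_inequality p M"
begin

sublocale fibre_metric M "iprod S" p
  using exponent cheeger by unfold_locales (auto simp: cheeger_structure_def)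

lemma exponent_pos: "0 < p"
  using exponent by simp

lemma grad_norm_eq: "grad_norm S u x = ip_norm (iprod S x) (grad S u x)"
  by (simp add: grad_norm_def ip_norm_def)

lemma flux_density_eq: "flux_density p S u w = field_flux (grad S u) (grad S w)"
  by (simp add: fun_eq_iff flux_density_def ip_flux_def grad_norm_eq)

lemma grad_lincomb:
  assumes "u \<in> newton_space p M" "v \<in> newton_space p M"
  shows "AE x in M. grad S (\<lambda>y. a * u y + b * v y) x = a *\<^sub>R grad S u x + b *\<^sub>R grad S v x"
  using cheeger assms by (auto simp: cheeger_structure_def)

lemma minimal_gradient:
  assumes "u \<in> newton_space p M"
  obtains K g where "1 \<le> K" "minimal_weak_upper_gradient p M u g"
    "AE x in M. g x \<le> ennreal (K * grad_norm S u x)"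
    "AE x in M. ennreal (grad_norm S u x) \<le> ennreal K * g x"
proof -
  obtain K where K: "1 \<le> K" "\<And>u. u \<in> newton_space p M \<Longrightarrow> \<exists>g. minimal_weak_upper_gradient p M u g \<and>
        (AE x in M. g x \<le> ennreal (K * grad_norm S u x) \<and>
                    ennreal (grad_norm S u x) \<le> ennreal K * g x)"
    using cheeger unfolding cheeger_structure_def by blast
  from K(2)[OF assms] obtain g where g: "minimal_weak_upper_gradient p M u g"
    "AE x in M. g x \<le> ennreal (K * grad_norm S u x) \<and> ennreal (grad_norm S u x) \<le> ennreal K * g x"
    by blast
  show ?thesis by (rule that[OF K(1) g(1)]) (use g(2) in auto)
qed

text \<open>
  The gradient norm is controlled by the minimal weak upper gradient, which lies in \<open>L\<^sup>p\<close>.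
\<close>

lemma grad_Lp:
  assumes u: "u \<in> newton_space p M"
  shows "Lp_field (grad S u)"
proof -
  have m: "grad S u \<in> borel_measurable M" using cheeger u by (auto simp: cheeger_structure_def)
  note [measurable] = measurable_field_norm[OF m]
  obtain K g where K: "1 \<le> K" and g: "minimal_weak_upper_gradient p M u g"
    and le: "AE x in M. ennreal (grad_norm S u x) \<le> ennreal K * g x"
    using minimal_gradient[OF u] by metis
  have [measurable]: "g \<in> borel_measurable M" and Lp: "enn_Lp_norm p M g < \<infinity>"
    using g by (auto simp: minimal_weak_upper_gradient_def weak_upper_gradient_def intro: borel_imp_measurable)
  have "(\<integral>\<^sup>+x. ennreal (ip_norm (iprod S x) (grad S u x) powr p) \<partial>M)
      \<le> (\<integral>\<^sup>+x. enn_powr (ennreal K) p * enn_powr (g x) p \<partial>M)"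
  proof (rule nn_integral_mono_AE)
    show "AE x in M. ennreal (ip_norm (iprod S x) (grad S u x) powr p) \<le> enn_powr (ennreal K) p * enn_powr (g x) p"
      using le AE_space
    proof eventually_elim
      case (elim x)
      have "ennreal (ip_norm (iprod S x) (grad S u x) powr p) = enn_powr (ennreal (grad_norm S u x)) p"
        using ip_norm_nonneg[OF fibre_ip[OF elim(2)]] by (simp add: enn_powr_ennreal grad_norm_eq)
      also have "\<dots> \<le> enn_powr (ennreal K * g x) p"
        by (rule enn_powr_mono[OF exponent_pos elim(1)])
      finally show ?case by (simp add: enn_powr_mult)
    qed
  qed
  also have "\<dots> = enn_powr (ennreal K) p * (\<integral>\<^sup>+x. enn_powr (g x) p \<partial>M)" by (simp add: nn_integral_cmult)
  also have "\<dots> < \<infinity>"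
  proof -
    have "enn_powr (ennreal K) p < \<infinity>" by (simp add: enn_powr_def)
    then show ?thesis using Lp unfolding enn_Lp_norm_finite_iff by (simp add: ennreal_mult_less_top)
  qed
  finally have "integrable M (\<lambda>x. ip_norm (iprod S x) (grad S u x) powr p)"
    by (intro integrableI_bounded) simp_all
  then show ?thesis using m by (simp add: Lp_field_def)
qed

lemma cheeger_energy_eq:
  assumes "u \<in> newton_space p M"
  shows "cheeger_energy p M S u = ennreal (field_energy (grad S u))"
  using grad_Lp[OF assms] unfolding cheeger_energy_def field_energy_def Lp_field_def grad_norm_eq
  by (intro nn_integral_eq_integral) auto

lemma field_energy_cong_AE:
  assumes "AE x in M. U x = W x" "U \<in> borel_measurable M" "W \<in> borel_measurable M"
  shows "field_energy U = field_energy W"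
proof -
  note [measurable] = measurable_field_norm[OF assms(2)] measurable_field_norm[OF assms(3)]
  show ?thesis unfolding field_energy_def
  proof (rule integral_cong_AE)
    show "AE x in M. ip_norm (iprod S x) (U x) powr p = ip_norm (iprod S x) (W x) powr p"
      using assms(1) by eventually_elim simp
  qed measurable
qed

lemma measurable_grad: "u \<in> newton_space p M \<Longrightarrow> grad S u \<in> borel_measurable M"
  using cheeger by (auto simp: cheeger_structure_def)

text \<open>
  The minimal weak upper gradient attains the infimum of the norms, so it vanishes almost everywhere,
  and it controls the gradient.
\<close>

lemma grad_zero_if_null_gradients:
  assumes u: "u \<in> newton_space p M" and INF: "(INF g\<in>Collect (weak_upper_gradient p M u). enn_Lp_norm p M g) = 0"
  shows "AE x in M. grad S u x = 0"
proof -
  obtain K g where K: "1 \<le> K" and g: "minimal_weak_upper_gradient p M u g"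
    and le: "AE x in M. ennreal (grad_norm S u x) \<le> ennreal K * g x"
    using minimal_gradient[OF u] by metis
  have [measurable]: "g \<in> borel_measurable M"
    using g by (auto simp: minimal_weak_upper_gradient_def weak_upper_gradient_def intro: borel_imp_measurable)
  have "enn_Lp_norm p M g \<le> enn_Lp_norm p M h" if h: "weak_upper_gradient p M u h" for h
  proof (cases "enn_Lp_norm p M h < \<infinity>")
    case True
    then have "AE x in M. g x \<le> h x" using g h by (auto simp: minimal_weak_upper_gradient_def)
    then have "AE x in M. enn_powr (g x) p \<le> enn_powr (h x) p"
      by eventually_elim (rule enn_powr_mono[OF exponent_pos])
    then show ?thesis unfolding enn_Lp_norm_def
      using exponent_pos by (intro enn_powr_mono nn_integral_mono_AE) auto
  qed (simp add: not_less top_unique)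
  then have "enn_Lp_norm p M g \<le> (INF g\<in>Collect (weak_upper_gradient p M u). enn_Lp_norm p M g)"
    by (intro INF_greatest) auto
  then have "AE x in M. g x = 0" using INF by (simp add: enn_Lp_norm_eq_0_iff)
  then show ?thesis using le AE_space
  proof eventually_elim
    case (elim x)
    then have "grad_norm S u x \<le> 0" by (simp add: ennreal_eq_0_iff)
    then show ?case
      using ip_norm_nonneg[OF fibre_ip[OF elim(3)]] ip_norm_eq_0[OF fibre_ip[OF elim(3)]]
      by (metis grad_norm_eq order_antisym)
  qed
qed

lemma null_gradient_if_grad_zero:
  assumes u: "u \<in> newton_space p M" and "AE x in M. grad S u x = 0"
  obtains g where "weak_upper_gradient p M u g" "AE x in M. g x = 0"
proof -
  obtain K g where K: "1 \<le> K" and g: "minimal_weak_upper_gradient p M u g"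
    and le: "AE x in M. g x \<le> ennreal (K * grad_norm S u x)"
    using minimal_gradient[OF u] by metis
  have "AE x in M. g x = 0" using le assms(2) AE_space
    by eventually_elim (simp add: grad_norm_eq ip_norm_eq_0[OF fibre_ip, THEN iffD2])
  then show ?thesis using that g by (auto simp: minimal_weak_upper_gradient_def)
qed

lemma grad_const: "AE x in M. grad S (\<lambda>_. c) x = 0"
proof (rule grad_zero_if_null_gradients[OF newton_space_const[OF exponent_pos]])
  have "(INF g\<in>Collect (weak_upper_gradient p M (\<lambda>_. c)). enn_Lp_norm p M g) \<le> enn_Lp_norm p M (\<lambda>_. 0)"
    using weak_upper_gradient_const by (intro INF_lower) auto
  then show "(INF g\<in>Collect (weak_upper_gradient p M (\<lambda>_. c)). enn_Lp_norm p M g) = 0"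
    by (simp add: enn_Lp_norm_def)
qed

lemma grad_add_const:
  assumes u: "u \<in> newton_space p M"
  shows "AE x in M. grad S (\<lambda>y. u y + c) x = grad S u x"
  using grad_lincomb[OF u newton_space_const[OF exponent_pos, of c], of 1 1] grad_const[of c]
  by eventually_elim simp

lemma grad_diff:
  assumes u: "u \<in> newton_space p M" "v \<in> newton_space p M"
  shows "AE x in M. grad S (\<lambda>y. u y - v y) x = grad S u x - grad S v x"
  using grad_lincomb[OF u, of 1 "-1"] by simp

lemma newton_space_add_const: "u \<in> newton_space p M \<Longrightarrow> (\<lambda>x. u x + c) \<in> newton_space p M"
  using newton_space_add[OF exponent_pos _ newton_space_const[OF exponent_pos]] .

text \<open>
  The difference \<open>v - u\<close> has a weak upper gradient vanishing almost everywhere, so the Poincare inequality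
  applies to it.
\<close>

lemma newton_norm_zero_if_grad_eq:
  assumes u: "u \<in> newton_space p M" "v \<in> newton_space p M"
    and eq: "AE x in M. grad S u x = grad S v x"
  shows "\<exists>c. newton_norm p M (\<lambda>x. v x - (u x + c)) = 0"
proof -
  have w: "(\<lambda>x. v x - u x) \<in> newton_space p M" using u by (intro newton_space_diff exponent_pos)
  have "AE x in M. grad S (\<lambda>x. v x - u x) x = 0"
    using grad_diff[OF u(2,1)] eq by eventually_elim simp
  then obtain g where g: "weak_upper_gradient p M (\<lambda>x. v x - u x) g" "AE x in M. g x = 0"
    using null_gradient_if_grad_zero[OF w] by metis
  have [measurable]: "g \<in> borel_measurable M"
    using g by (auto simp: weak_upper_gradient_def intro: borel_imp_measurable)
  obtain c where c: "AE x in M. v x - u x = c"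
    using poincare_zero_gradient_const[OF exponent bounded_space pos_balls poincare w g] by blast
  have [measurable]: "u \<in> borel_measurable M" "v \<in> borel_measurable M"
    using u by (auto simp: newton_space_def)
  have "enn_Lp_norm p M (\<lambda>x. ennreal \<bar>v x - (u x + c)\<bar>) = 0"
  proof (subst enn_Lp_norm_eq_0_iff)
    show "AE x in M. ennreal \<bar>v x - (u x + c)\<bar> = 0" using c by eventually_elim simp
  qed measurable
  moreover have "weak_upper_gradient p M (\<lambda>x. v x - (u x + c)) g"
    using g(1) unfolding weak_upper_gradient_def by (simp add: algebra_simps)
  then have "(INF g\<in>Collect (weak_upper_gradient p M (\<lambda>x. v x - (u x + c))). enn_Lp_norm p M g)
      \<le> enn_Lp_norm p M g" by (intro INF_lower) auto
  then have "(INF g\<in>Collect (weak_upper_gradient p M (\<lambda>x. v x - (u x + c))). enn_Lp_norm p M g) = 0"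
    using g(2) enn_Lp_norm_eq_0_iff[of g M p] by simp
  ultimately show ?thesis by (auto simp: newton_norm_def)
qed

lemma newton_norm_zero_imp:
  assumes w: "w \<in> newton_space p M" and z: "newton_norm p M w = 0"
  shows "AE x in M. w x = 0" "AE x in M. grad S w x = 0"
proof -
  have [measurable]: "w \<in> borel_measurable M" using w by (simp add: newton_space_def)
  have 0: "enn_Lp_norm p M (\<lambda>x. ennreal \<bar>w x\<bar>) = 0"
    "(INF g\<in>Collect (weak_upper_gradient p M w). enn_Lp_norm p M g) = 0"
    using z by (auto simp: newton_norm_def)
  show "AE x in M. w x = 0" using 0(1) by (simp add: enn_Lp_norm_eq_0_iff)
  show "AE x in M. grad S w x = 0" using grad_zero_if_null_gradients[OF w 0(2)] .
qed

end

section \<open>Boundary classes\<close>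

lemma hb_class_self: "f \<in> besov_space p \<theta> \<nu> \<Longrightarrow> f \<in> hb_class p \<theta> \<nu> f"
  by (auto simp: hb_class_def intro: exI[of _ 0])

lemma hb_space_memD:
  assumes "F \<in> hb_space p \<theta> \<nu>" "f \<in> F"
  shows "f \<in> besov_space p \<theta> \<nu>"
  using assms by (auto simp: hb_space_def hb_class_def)

lemma hb_space_some_mem:
  assumes "F \<in> hb_space p \<theta> \<nu>"
  shows "(SOME f. f \<in> F) \<in> F"
proof -
  obtain f where "f \<in> besov_space p \<theta> \<nu>" "F = hb_class p \<theta> \<nu> f" using assms by (auto simp: hb_space_def)
  then have "F \<noteq> {}" using hb_class_self by blast
  then show ?thesis by (simp add: some_in_eq)
qed

lemma hb_space_mem_diff:
  assumes "F \<in> hb_space p \<theta> \<nu>" "f \<in> F" "f' \<in> F"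
  shows "\<exists>c. AE x in \<nu>. f' x = f x + c"
proof -
  obtain f0 where "F = hb_class p \<theta> \<nu> f0" using assms by (auto simp: hb_space_def)
  then obtain a b where "AE x in \<nu>. f x = f0 x + a" "AE x in \<nu>. f' x = f0 x + b"
    using assms by (auto simp: hb_class_def)
  then have "AE x in \<nu>. f' x = f x + (b - a)" by eventually_elim simp
  then show ?thesis by blast
qed

lemma hb_space_add_const:
  assumes "F \<in> hb_space p \<theta> \<nu>" "f \<in> F"
  shows "(\<lambda>x. f x + c) \<in> F"
proof -
  obtain f0 where F: "F = hb_class p \<theta> \<nu> f0" using assms by (auto simp: hb_space_def)
  then obtain a where "AE x in \<nu>. f x = f0 x + a" using assms by (auto simp: hb_class_def)
  then have "AE x in \<nu>. f x + c = f0 x + (a + c)" by eventually_elim simp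
  then show ?thesis
    using besov_space_add_const[OF hb_space_memD[OF assms], of c] by (auto simp: F hb_class_def)
qed

section \<open>The Dirichlet problem and the Dirichlet-to-Neumann map\<close>

text \<open>
  The vector space properties of the Besov space are assumed here, since their proof depends on
  whether the boundary is a single point.
\<close>

locale dirichlet_problem = cheeger_space M p S
  for M :: "'a::metric_space measure" and p :: real and S :: "('a, 'n::finite) cheeger" +
  fixes \<nu> :: "'a measure" and \<theta> :: real and E :: "('a \<Rightarrow> real) \<Rightarrow> 'a \<Rightarrow> real"
  assumes besov_lincomb: "f \<in> besov_space p \<theta> \<nu> \<Longrightarrow> g \<in> besov_space p \<theta> \<nu> \<Longrightarrow>
      (\<lambda>x. a * f x + b * g x) \<in> besov_space p \<theta> \<nu>"
    and besov_scale: "f \<in> besov_space p \<theta> \<nu> \<Longrightarrow>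
      besov_norm p \<theta> \<nu> (\<lambda>x. a * f x) = ennreal \<bar>a\<bar> * besov_norm p \<theta> \<nu> f"
    and extension: "extension_operator p \<theta> M \<nu> S E"
    and solvable: "f \<in> besov_space p \<theta> \<nu> \<Longrightarrow> \<exists>u. dirichlet_solution p M \<nu> S f u"
begin

lemma solution_newton: "dirichlet_solution p M \<nu> S f u \<Longrightarrow> u \<in> newton_space p M"
  and solution_trace: "dirichlet_solution p M \<nu> S f u \<Longrightarrow> has_trace M \<nu> u f"
  by (auto simp: dirichlet_solution_def)

lemma newton_measurable: "u \<in> newton_space p M \<Longrightarrow> u \<in> borel_measurable M"
  by (simp add: newton_space_def)

lemma has_trace_diff:
  assumes "u \<in> newton_space p M" "v \<in> newton_space p M" "has_trace M \<nu> u f" "has_trace M \<nu> v g"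
  shows "has_trace M \<nu> (\<lambda>x. u x - v x) (\<lambda>x. f x - g x)"
  using has_trace_lincomb[OF newton_measurable[OF assms(1)] newton_measurable[OF assms(2)] assms(3,4), of 1 "-1"]
  by simp

lemma has_trace_add_const:
  assumes "u \<in> newton_space p M" "has_trace M \<nu> u f"
  shows "has_trace M \<nu> (\<lambda>x. u x + c) (\<lambda>x. f x + c)"
  using has_trace_lincomb[OF newton_measurable[OF assms(1)] _ assms(2) has_trace_const, of 1 1 c]
  by simp

lemma newton_0_if_trace_const:
  assumes w: "w \<in> newton_space p M" and tr: "has_trace M \<nu> w g" and g: "AE x in \<nu>. g x = c"
  shows "(\<lambda>x. w x + - c) \<in> newton_space_0 p M \<nu>"
proof -
  have "has_trace M \<nu> (\<lambda>x. w x + - c) (\<lambda>x. g x + - c)" by (rule has_trace_add_const[OF w tr])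
  then have "has_trace M \<nu> (\<lambda>x. w x + - c) (\<lambda>_. 0)"
  proof (rule has_trace_AE_cong)
    show "AE x in \<nu>. g x + - c = 0" using g by eventually_elim simp
  qed simp
  then show ?thesis using newton_space_add_const[OF w, of "- c"] by (simp add: newton_space_0_def)
qed

lemma flux_cong_grad:
  assumes "u \<in> newton_space p M" "u' \<in> newton_space p M" "w \<in> newton_space p M" "w' \<in> newton_space p M"
    and "AE x in M. grad S u x = grad S u' x" "AE x in M. grad S w x = grad S w' x"
  shows "(LINT x|M. flux_density p S u w x) = (LINT x|M. flux_density p S u' w' x)"
  unfolding flux_density_eq
proof (rule integral_cong_AE)
  show "AE x in M. field_flux (grad S u) (grad S w) x = field_flux (grad S u') (grad S w') x"
    using assms(5,6) by eventually_elim simp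
qed (intro measurable_field_flux measurable_grad assms)+

lemma integrable_flux:
  assumes "u \<in> newton_space p M" "w \<in> newton_space p M"
  shows "integrable M (flux_density p S u w)"
  unfolding flux_density_eq by (intro integrable_field_flux grad_Lp assms)

lemma euler_lagrange:
  assumes u: "dirichlet_solution p M \<nu> S f u" and v: "v \<in> newton_space_0 p M \<nu>"
  shows "(LINT x|M. flux_density p S u v x) = 0"
  unfolding flux_density_eq
proof (rule field_euler_lagrange)
  have N: "u \<in> newton_space p M" "v \<in> newton_space p M"
    using u v by (auto simp: newton_space_0_def solution_newton)
  show "Lp_field (grad S u)" "Lp_field (grad S v)" using N by (auto intro: grad_Lp)
  fix t :: real
  have tv: "(\<lambda>x. t * v x) \<in> newton_space p M"
    using newton_space_lincomb[OF exponent_pos N(2,2), of t 0] by simp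
  have "has_trace M \<nu> (\<lambda>x. t * v x) (\<lambda>_. 0)"
    using v has_trace_lincomb[OF newton_measurable[OF N(2)] newton_measurable[OF N(2)], of \<nu> "\<lambda>_. 0" "\<lambda>_. 0" t 0]
    by (simp add: newton_space_0_def)
  then have "cheeger_energy p M S u \<le> cheeger_energy p M S (\<lambda>x. u x + t * v x)"
    using u tv by (auto simp: dirichlet_solution_def newton_space_0_def)
  moreover have utv: "(\<lambda>x. u x + t * v x) \<in> newton_space p M"
    using newton_space_lincomb[OF exponent_pos N, of 1 t] by simp
  moreover have "field_energy (grad S (\<lambda>x. u x + t * v x)) = field_energy (\<lambda>x. grad S u x + t *\<^sub>R grad S v x)"
  proof (rule field_energy_cong_AE)
    show "AE x in M. grad S (\<lambda>x. u x + t * v x) x = grad S u x + t *\<^sub>R grad S v x"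
      using grad_lincomb[OF N, of 1 t] by simp
    show "(\<lambda>x. grad S u x + t *\<^sub>R grad S v x) \<in> borel_measurable M"
      using measurable_grad[OF N(1)] measurable_grad[OF N(2)] by measurable
  qed (rule measurable_grad[OF utv])
  ultimately show "field_energy (grad S u) \<le> field_energy (\<lambda>x. grad S u x + t *\<^sub>R grad S v x)"
    using N(1) field_energy_nonneg by (simp add: cheeger_energy_eq ennreal_le_iff)
qed

text \<open>
  After subtracting \<open>c\<close>, the difference of \<open>w'\<close> and \<open>w\<close> has trace zero, so the Euler-Lagrange equation
  applies to it, and the constant does not affect the gradient.
\<close>

lemma flux_depends_on_trace:
  assumes u: "dirichlet_solution p M \<nu> S f u"
    and w: "w \<in> newton_space p M" "has_trace M \<nu> w g"
    and w': "w' \<in> newton_space p M" "has_trace M \<nu> w' g'"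
    and c: "AE x in \<nu>. g' x = g x + c"
  shows "(LINT x|M. flux_density p S u w' x) = (LINT x|M. flux_density p S u w x)"
proof -
  note uN = solution_newton[OF u]
  let ?d = "\<lambda>x. w' x - w x + - c"
  have dN: "(\<lambda>x. w' x - w x) \<in> newton_space p M" by (intro newton_space_diff exponent_pos w w')
  have "AE x in \<nu>. g' x - g x = c" using c by eventually_elim simp
  then have d: "?d \<in> newton_space_0 p M \<nu>"
    by (rule newton_0_if_trace_const[OF dN has_trace_diff[OF w'(1) w(1) w'(2) w(2)]])
  then have dN': "?d \<in> newton_space p M" by (simp add: newton_space_0_def)
  have "AE x in M. field_flux (grad S u) (grad S ?d) x
      = field_flux (grad S u) (grad S w') x - field_flux (grad S u) (grad S w) x"
    using grad_add_const[OF dN, of "- c"] grad_diff[OF w'(1) w(1)] AE_space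
    by eventually_elim (simp add: ip_flux_diff[OF fibre_ip])
  then have "(LINT x|M. field_flux (grad S u) (grad S ?d) x)
      = (LINT x|M. field_flux (grad S u) (grad S w') x - field_flux (grad S u) (grad S w) x)"
    by (rule integral_cong_AE[rotated 2])
      (intro measurable_field_flux borel_measurable_diff measurable_grad uN dN' w w')+
  also have "\<dots> = (LINT x|M. field_flux (grad S u) (grad S w') x) - (LINT x|M. field_flux (grad S u) (grad S w) x)"
    by (intro Bochner_Integration.integral_diff integrable_field_flux grad_Lp uN w w')
  finally show ?thesis using euler_lagrange[OF u d] by (simp add: flux_density_eq)
qed

text \<open>
  The function \<open>u + c\<close> competes with \<open>u'\<close> and has the energy of \<open>u\<close>. Moreover the flux of \<open>u\<close> against
  \<open>u' - u\<close> vanishes, because the trace of \<open>u' - u\<close> is constant. This is the equality case of the tangent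
  inequality.
\<close>

lemma solution_gradient_unique:
  assumes u: "dirichlet_solution p M \<nu> S f u" and u': "dirichlet_solution p M \<nu> S f' u'"
    and c: "AE x in \<nu>. f' x = f x + c"
  shows "AE x in M. grad S u x = grad S u' x"
proof (rule field_energy_strict)
  note N = solution_newton[OF u] and N' = solution_newton[OF u']
  show "Lp_field (grad S u)" "Lp_field (grad S u')" using N N' by (auto intro: grad_Lp)
  have "(LINT x|M. field_flux (grad S u) (\<lambda>x. grad S u' x - grad S u x) x)
      = (LINT x|M. field_flux (grad S u) (grad S u') x - field_flux (grad S u) (grad S u) x)"
    by (rule Bochner_Integration.integral_cong) (simp_all add: ip_flux_diff[OF fibre_ip])
  also have "\<dots> = (LINT x|M. flux_density p S u u' x) - (LINT x|M. flux_density p S u u x)"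
    unfolding flux_density_eq
    by (intro Bochner_Integration.integral_diff integrable_field_flux grad_Lp N N')
  also have "\<dots> = 0"
    using flux_depends_on_trace[OF u N solution_trace[OF u] N' solution_trace[OF u'] c] by simp
  finally show "(LINT x|M. field_flux (grad S u) (\<lambda>x. grad S u' x - grad S u x) x) = 0" .
  have d: "(\<lambda>x. u x - u' x) \<in> newton_space p M" by (intro newton_space_diff exponent_pos N N')
  have "AE x in \<nu>. f x - f' x = - c" using c by eventually_elim simp
  then have v: "(\<lambda>x. (u x - u' x) + - (- c)) \<in> newton_space_0 p M \<nu>"
    by (rule newton_0_if_trace_const[OF d has_trace_diff[OF N N' solution_trace[OF u] solution_trace[OF u']]])
  have "cheeger_energy p M S u' \<le> cheeger_energy p M S (\<lambda>x. u' x + ((u x - u' x) + - (- c)))"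
    using u' v by (auto simp: dirichlet_solution_def)
  also have "(\<lambda>x. u' x + ((u x - u' x) + - (- c))) = (\<lambda>x. u x + c)" by auto
  finally have "field_energy (grad S u') \<le> field_energy (grad S (\<lambda>x. u x + c))"
    using N N' newton_space_add_const[OF N, of c] by (simp add: cheeger_energy_eq field_energy_nonneg)
  also have "\<dots> = field_energy (grad S u)"
    by (intro field_energy_cong_AE grad_add_const measurable_grad newton_space_add_const N)
  finally show "field_energy (grad S u') \<le> field_energy (grad S u)" .
qed

lemma solution_if_newton_norm_zero:
  assumes u: "dirichlet_solution p M \<nu> S f u" and v: "v \<in> newton_space p M"
    and z: "newton_norm p M (\<lambda>x. v x - (u x + c)) = 0"
  shows "dirichlet_solution p M \<nu> S (\<lambda>x. f x + c) v"
proof -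
  note N = solution_newton[OF u]
  have uc: "(\<lambda>x. u x + c) \<in> newton_space p M" by (rule newton_space_add_const[OF N])
  have d: "(\<lambda>x. v x - (u x + c)) \<in> newton_space p M"
    by (intro newton_space_diff exponent_pos v uc)
  have eq: "AE x in M. u x + c = v x"
    using newton_norm_zero_imp(1)[OF d z] by eventually_elim simp
  have geq: "AE x in M. grad S v x = grad S u x"
    using newton_norm_zero_imp(2)[OF d z] grad_diff[OF v uc] grad_add_const[OF N, of c]
    by eventually_elim simp
  have tr: "has_trace M \<nu> v (\<lambda>x. f x + c)"
    by (rule has_trace_AE_cong[OF has_trace_add_const[OF N solution_trace[OF u]] eq]) simp
  have "cheeger_energy p M S v \<le> cheeger_energy p M S (\<lambda>x. v x + w x)"
    if w: "w \<in> newton_space_0 p M \<nu>" for w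
  proof -
    have wN: "w \<in> newton_space p M" using w by (simp add: newton_space_0_def)
    note uw = newton_space_add[OF exponent_pos N wN] and vw = newton_space_add[OF exponent_pos v wN]
    have "field_energy (grad S v) = field_energy (grad S u)"
      by (intro field_energy_cong_AE geq measurable_grad N v)
    moreover have "field_energy (grad S (\<lambda>x. v x + w x)) = field_energy (grad S (\<lambda>x. u x + w x))"
    proof (intro field_energy_cong_AE measurable_grad uw vw)
      show "AE x in M. grad S (\<lambda>x. v x + w x) x = grad S (\<lambda>x. u x + w x) x"
        using grad_lincomb[OF v wN, of 1 1] grad_lincomb[OF N wN, of 1 1] geq by eventually_elim simp
    qed
    moreover have "cheeger_energy p M S u \<le> cheeger_energy p M S (\<lambda>x. u x + w x)"
      using u w by (auto simp: dirichlet_solution_def)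
    ultimately show ?thesis by (simp add: cheeger_energy_eq N v uw vw)
  qed
  then show ?thesis using v tr by (simp add: dirichlet_solution_def)
qed

text \<open>
  Solutions for different representatives have equal gradients, so they differ by a constant up to a null
  function; conversely such a change turns a solution for \<open>f\<close> into one for \<open>f + c\<close>.
\<close>

lemma dirichlet_class_hn_space:
  assumes F: "F \<in> hb_space p \<theta> \<nu>"
  shows "dirichlet_class p M \<nu> S F \<in> hn_space p M"
proof -
  obtain f where f: "f \<in> F" using hb_space_some_mem[OF F] by blast
  obtain u where u: "dirichlet_solution p M \<nu> S f u" using solvable[OF hb_space_memD[OF F f]] by blast
  note N = solution_newton[OF u]
  have "dirichlet_class p M \<nu> S F = hn_class p M u"
  proof (intro equalityI subsetI)
    fix v assume "v \<in> dirichlet_class p M \<nu> S F"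
    then obtain f' where f': "f' \<in> F" "dirichlet_solution p M \<nu> S f' v"
      by (auto simp: dirichlet_class_def)
    obtain c where "AE x in \<nu>. f' x = f x + c" using hb_space_mem_diff[OF F f f'(1)] by blast
    then have "AE x in M. grad S u x = grad S v x" by (rule solution_gradient_unique[OF u f'(2)])
    then show "v \<in> hn_class p M u"
      using newton_norm_zero_if_grad_eq[OF N solution_newton[OF f'(2)]] solution_newton[OF f'(2)]
      by (auto simp: hn_class_def)
  next
    fix v assume "v \<in> hn_class p M u"
    then obtain c where "v \<in> newton_space p M" "newton_norm p M (\<lambda>x. v x - (u x + c)) = 0"
      by (auto simp: hn_class_def)
    then show "v \<in> dirichlet_class p M \<nu> S F"
      using solution_if_newton_norm_zero[OF u] hb_space_add_const[OF F f]
      by (auto simp: dirichlet_class_def)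
  qed
  then show ?thesis using N by (auto simp: hn_space_def)
qed

lemma extension_newton: "g \<in> besov_space p \<theta> \<nu> \<Longrightarrow> E g \<in> newton_space p M"
  and extension_trace: "g \<in> besov_space p \<theta> \<nu> \<Longrightarrow> has_trace M \<nu> (E g) g"
  using extension by (auto simp: extension_operator_def)

lemma dirichlet_class_solution:
  assumes "u \<in> dirichlet_class p M \<nu> S F"
  obtains f where "f \<in> F" "dirichlet_solution p M \<nu> S f u"
  using assms by (auto simp: dirichlet_class_def)

lemma dirichlet_class_some_mem:
  assumes F: "F \<in> hb_space p \<theta> \<nu>"
  shows "(SOME u. u \<in> dirichlet_class p M \<nu> S F) \<in> dirichlet_class p M \<nu> S F"
  unfolding some_in_eq
  using hb_space_some_mem[OF F] solvable hb_space_memD[OF F] by (force simp: dirichlet_class_def)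

text \<open>
  Both choices inside \<open>DtN\<close> are immaterial: solutions for the same class have equal gradients, and
  extensions of representatives of the same class have traces differing by a constant. The function \<open>w\<close> need not
  be \<open>E g\<close>; linearity of \<open>DtN p M \<nu> S E F\<close> is obtained with \<open>w = a Ef + b Eg\<close>.
\<close>

lemma DtN_eq:
  assumes F: "F \<in> hb_space p \<theta> \<nu>" and u: "u \<in> dirichlet_class p M \<nu> S F"
    and G: "G \<in> hb_space p \<theta> \<nu>" and g: "g \<in> G"
    and w: "w \<in> newton_space p M" "has_trace M \<nu> w g"
  shows "DtN p M \<nu> S E F G = (LINT x|M. flux_density p S u w x)"
proof -
  let ?u = "SOME u. u \<in> dirichlet_class p M \<nu> S F" and ?g = "SOME g. g \<in> G"
  obtain f where f: "f \<in> F" "dirichlet_solution p M \<nu> S f u"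
    using dirichlet_class_solution[OF u] by blast
  obtain f' where f': "f' \<in> F" "dirichlet_solution p M \<nu> S f' ?u"
    using dirichlet_class_solution[OF dirichlet_class_some_mem[OF F]] by blast
  obtain c where c: "AE x in \<nu>. f x = f' x + c" using hb_space_mem_diff[OF F f'(1) f(1)] by blast
  have gB: "?g \<in> besov_space p \<theta> \<nu>" by (rule hb_space_memD[OF G hb_space_some_mem[OF G]])
  obtain c' where c': "AE x in \<nu>. ?g x = g x + c'"
    using hb_space_mem_diff[OF G g hb_space_some_mem[OF G]] by blast
  have "DtN p M \<nu> S E F G = (LINT x|M. flux_density p S u (E ?g) x)"
    unfolding DtN_def using solution_gradient_unique[OF f'(2) f(2) c]
    by (intro flux_cong_grad extension_newton gB solution_newton[OF f(2)] solution_newton[OF f'(2)]) auto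
  also have "\<dots> = (LINT x|M. flux_density p S u w x)"
    by (rule flux_depends_on_trace[OF f(2) w extension_newton[OF gB] extension_trace[OF gB] c'])
  finally show ?thesis .
qed

abbreviation extension_constant :: real where
  "extension_constant \<equiv> enn2real (extension_norm p \<theta> M \<nu> S E)"

lemma extension_norm_eq: "extension_norm p \<theta> M \<nu> S E = ennreal extension_constant"
  using extension by (simp add: extension_operator_def)

lemma extension_energy_unit:
  assumes f: "f \<in> besov_space p \<theta> \<nu>" "besov_norm p \<theta> \<nu> f \<le> 1"
  shows "field_energy (grad S (E f)) powr (1 / p) \<le> extension_constant"
proof -
  have "enn_powr (cheeger_energy p M S (E f)) (1 / p) \<le> extension_norm p \<theta> M \<nu> S E"
    unfolding extension_norm_def using f by (intro SUP_upper) auto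
  also have "\<dots> = ennreal extension_constant" by (rule extension_norm_eq)
  finally show ?thesis
    by (simp add: cheeger_energy_eq extension_newton f enn_powr_ennreal field_energy_nonneg ennreal_le_iff)
qed

lemma grad_extension_scale:
  assumes f: "f \<in> besov_space p \<theta> \<nu>"
  shows "AE x in M. grad S (E (\<lambda>\<xi>. t * f \<xi>)) x = t *\<^sub>R grad S (E f) x"
proof -
  have tf: "(\<lambda>\<xi>. t * f \<xi>) \<in> besov_space p \<theta> \<nu>" using besov_lincomb[OF f f, of t 0] by simp
  note N = extension_newton[OF f] and tN = extension_newton[OF tf]
  have "newton_norm p M (\<lambda>x. E (\<lambda>\<xi>. t * f \<xi> + 0 * f \<xi>) x - (t * E f x + 0 * E f x)) = 0"
    using extension f unfolding extension_operator_def by blast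
  then have z: "newton_norm p M (\<lambda>x. E (\<lambda>\<xi>. t * f \<xi>) x - t * E f x) = 0" by simp
  have sN: "(\<lambda>x. t * E f x) \<in> newton_space p M"
    using newton_space_lincomb[OF exponent_pos N N, of t 0] by simp
  have dN: "(\<lambda>x. E (\<lambda>\<xi>. t * f \<xi>) x - t * E f x) \<in> newton_space p M"
    by (rule newton_space_diff[OF exponent_pos tN sN])
  show ?thesis
    using newton_norm_zero_imp(2)[OF dN z] grad_diff[OF tN sN] grad_lincomb[OF N N, of t 0]
    by eventually_elim simp
qed

lemma extension_energy_scale:
  assumes f: "f \<in> besov_space p \<theta> \<nu>"
  shows "field_energy (grad S (E (\<lambda>\<xi>. t * f \<xi>))) powr (1 / p)
      = \<bar>t\<bar> * field_energy (grad S (E f)) powr (1 / p)"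
proof -
  have tf: "(\<lambda>\<xi>. t * f \<xi>) \<in> besov_space p \<theta> \<nu>" using besov_lincomb[OF f f, of t 0] by simp
  have m: "grad S (E f) \<in> borel_measurable M" by (intro measurable_grad extension_newton f)
  have "field_energy (grad S (E (\<lambda>\<xi>. t * f \<xi>))) = field_energy (\<lambda>x. t *\<^sub>R grad S (E f) x)"
    using m by (intro field_energy_cong_AE grad_extension_scale f measurable_grad extension_newton tf) measurable
  also have "\<dots> = \<bar>t\<bar> powr p * field_energy (grad S (E f))"
    by (intro Lp_field_scale grad_Lp extension_newton f)
  finally show ?thesis
    using exponent by (simp add: powr_mult powr_powr field_energy_nonneg)
qed

text \<open>
  Homogeneity reduces this to unit vectors. If the norm of \<open>f\<close> is zero, all multiples of \<open>f\<close> lie in the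
  unit ball, so the energy of its extension must vanish.
\<close>

lemma extension_energy_bound:
  assumes f: "f \<in> besov_space p \<theta> \<nu>"
  shows "ennreal (field_energy (grad S (E f)) powr (1 / p)) \<le> ennreal extension_constant * besov_norm p \<theta> \<nu> f"
proof -
  let ?a = "field_energy (grad S (E f)) powr (1 / p)"
  obtain n where n: "besov_norm p \<theta> \<nu> f = ennreal n" "0 \<le> n"
    using f by (cases "besov_norm p \<theta> \<nu> f") (auto simp: besov_space_def)
  have tf: "(\<lambda>\<xi>. t * f \<xi>) \<in> besov_space p \<theta> \<nu>" for t using besov_lincomb[OF f f, of t 0] by simp
  have unit: "t * ?a \<le> extension_constant" if "0 \<le> t" "t * n \<le> 1" for t
  proof -
    have "besov_norm p \<theta> \<nu> (\<lambda>\<xi>. t * f \<xi>) \<le> 1"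
      using that n by (simp add: besov_scale f flip: ennreal_mult)
    from extension_energy_unit[OF tf this] show ?thesis
      using that by (simp add: extension_energy_scale f)
  qed
  have "?a \<le> extension_constant * n"
  proof (cases "n = 0")
    case False
    then show ?thesis using unit[of "1 / n"] n by (simp add: field_simps)
  next
    case True
    have "\<not> 0 < ?a"
    proof
      assume "0 < ?a"
      \<comment> \<open>The factor is chosen so that the left-hand side is \<open>extension_constant + 1\<close>.\<close>
      moreover have "(extension_constant + 1) / ?a * ?a \<le> extension_constant"
        by (rule unit) (simp_all add: True)
      ultimately show False by simp
    qed
    then show ?thesis using True by (simp add: not_less)
  qed
  then show ?thesis using n by (simp add: ennreal_leI flip: ennreal_mult)
qed

text \<open>
  The extension \<open>E f\<close> is itself admissible in the Dirichlet problem.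
\<close>

lemma solution_energy_le:
  assumes u: "dirichlet_solution p M \<nu> S f u" and f: "f \<in> besov_space p \<theta> \<nu>"
  shows "field_energy (grad S u) \<le> field_energy (grad S (E f))"
proof -
  note N = solution_newton[OF u] and EN = extension_newton[OF f]
  have "(\<lambda>x. E f x - u x + - 0) \<in> newton_space_0 p M \<nu>"
    by (rule newton_0_if_trace_const[OF newton_space_diff[OF exponent_pos EN N]
          has_trace_diff[OF EN N extension_trace[OF f] solution_trace[OF u]]]) simp
  then have "cheeger_energy p M S u \<le> cheeger_energy p M S (\<lambda>x. u x + (E f x - u x + - 0))"
    using u by (auto simp: dirichlet_solution_def)
  then show ?thesis by (simp add: cheeger_energy_eq N EN field_energy_nonneg)
qed

lemma DtN_bound:
  assumes F: "F \<in> hb_space p \<theta> \<nu>" and G: "G \<in> hb_space p \<theta> \<nu>"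
  shows "ennreal \<bar>DtN p M \<nu> S E F G\<bar>
      \<le> ennreal ((field_energy (grad S (E (SOME f. f \<in> F))) powr (1 / p)) powr (p - 1))
        * (ennreal extension_constant * hb_norm p \<theta> \<nu> G)"
proof -
  let ?f = "SOME f. f \<in> F" and ?g = "SOME g. g \<in> G"
  have fB: "?f \<in> besov_space p \<theta> \<nu>" by (rule hb_space_memD[OF F hb_space_some_mem[OF F]])
  have gB: "?g \<in> besov_space p \<theta> \<nu>" by (rule hb_space_memD[OF G hb_space_some_mem[OF G]])
  obtain u where u: "dirichlet_solution p M \<nu> S ?f u" using solvable[OF fB] by blast
  have uF: "u \<in> dirichlet_class p M \<nu> S F"
    using u hb_space_some_mem[OF F] by (auto simp: dirichlet_class_def)
  have "DtN p M \<nu> S E F G = (LINT x|M. field_flux (grad S u) (grad S (E ?g)) x)"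
    using DtN_eq[OF F uF G hb_space_some_mem[OF G] extension_newton[OF gB] extension_trace[OF gB]]
    by (simp add: flux_density_eq)
  also have "\<bar>\<dots>\<bar> \<le> field_energy (grad S u) powr ((p - 1) / p) * field_energy (grad S (E ?g)) powr (1 / p)"
    by (intro field_holder grad_Lp extension_newton gB solution_newton[OF u])
  also have "\<dots> \<le> field_energy (grad S (E ?f)) powr ((p - 1) / p) * field_energy (grad S (E ?g)) powr (1 / p)"
    using exponent by (intro mult_right_mono powr_mono2 solution_energy_le u fB) (auto simp: field_energy_nonneg)
  also have "field_energy (grad S (E ?f)) powr ((p - 1) / p)
      = (field_energy (grad S (E ?f)) powr (1 / p)) powr (p - 1)" by (simp add: powr_powr)
  finally have "ennreal \<bar>DtN p M \<nu> S E F G\<bar>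
      \<le> ennreal ((field_energy (grad S (E ?f)) powr (1 / p)) powr (p - 1))
        * ennreal (field_energy (grad S (E ?g)) powr (1 / p))"
    by (simp add: ennreal_leI flip: ennreal_mult)
  also have "\<dots> \<le> ennreal ((field_energy (grad S (E ?f)) powr (1 / p)) powr (p - 1))
        * (ennreal extension_constant * besov_norm p \<theta> \<nu> ?g)"
    by (intro mult_left_mono extension_energy_bound gB) simp
  finally show ?thesis by (simp add: hb_norm_def)
qed

lemma DtN_dual:
  assumes F: "F \<in> hb_space p \<theta> \<nu>"
  shows "DtN p M \<nu> S E F \<in> hb_dual p \<theta> \<nu>"
proof -
  let ?u = "SOME u. u \<in> dirichlet_class p M \<nu> S F"
  note u = dirichlet_class_some_mem[OF F]
  obtain f0 where f0: "dirichlet_solution p M \<nu> S f0 ?u"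
    using dirichlet_class_solution[OF u] by blast
  note N = solution_newton[OF f0]
  have lin: "DtN p M \<nu> S E F (hb_class p \<theta> \<nu> (\<lambda>x. a * f x + b * g x))
      = a * DtN p M \<nu> S E F (hb_class p \<theta> \<nu> f) + b * DtN p M \<nu> S E F (hb_class p \<theta> \<nu> g)"
    if f: "f \<in> besov_space p \<theta> \<nu>" and g: "g \<in> besov_space p \<theta> \<nu>" for f g a b
  proof -
    let ?h = "\<lambda>x. a * f x + b * g x" and ?w = "\<lambda>x. a * E f x + b * E g x"
    have h: "?h \<in> besov_space p \<theta> \<nu>" by (rule besov_lincomb[OF f g])
    have w: "?w \<in> newton_space p M"
      by (intro newton_space_lincomb exponent_pos extension_newton f g)
    have tr: "has_trace M \<nu> ?w ?h"
      by (intro has_trace_lincomb newton_measurable extension_newton extension_trace f g)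
    have cl: "hb_class p \<theta> \<nu> k \<in> hb_space p \<theta> \<nu>" if "k \<in> besov_space p \<theta> \<nu>" for k
      using that by (simp add: hb_space_def)
    have "DtN p M \<nu> S E F (hb_class p \<theta> \<nu> ?h) = (LINT x|M. field_flux (grad S ?u) (grad S ?w) x)"
      using DtN_eq[OF F u cl[OF h] hb_class_self[OF h] w tr] by (simp add: flux_density_eq)
    also have "\<dots> = (LINT x|M. a * field_flux (grad S ?u) (grad S (E f)) x
        + b * field_flux (grad S ?u) (grad S (E g)) x)"
    proof (rule integral_cong_AE)
      show "AE x in M. field_flux (grad S ?u) (grad S ?w) x
        = a * field_flux (grad S ?u) (grad S (E f)) x + b * field_flux (grad S ?u) (grad S (E g)) x"
        using grad_lincomb[OF extension_newton[OF f] extension_newton[OF g], of a b] AE_space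
        by eventually_elim (simp add: ip_flux_add[OF fibre_ip] ip_flux_scale[OF fibre_ip])
    qed (intro measurable_field_flux borel_measurable_add borel_measurable_times borel_measurable_const
        measurable_grad N w extension_newton f g)+
    also have "\<dots> = a * (LINT x|M. flux_density p S ?u (E f) x) + b * (LINT x|M. flux_density p S ?u (E g) x)"
      using integrable_flux[OF N extension_newton[OF f]] integrable_flux[OF N extension_newton[OF g]]
      by (simp add: flux_density_eq)
    also have "(LINT x|M. flux_density p S ?u (E f) x) = DtN p M \<nu> S E F (hb_class p \<theta> \<nu> f)"
      using DtN_eq[OF F u cl[OF f] hb_class_self[OF f] extension_newton[OF f] extension_trace[OF f]] by simp
    also have "(LINT x|M. flux_density p S ?u (E g) x) = DtN p M \<nu> S E F (hb_class p \<theta> \<nu> g)"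
      using DtN_eq[OF F u cl[OF g] hb_class_self[OF g] extension_newton[OF g] extension_trace[OF g]] by simp
    finally show ?thesis .
  qed
  let ?C = "(field_energy (grad S (E (SOME f. f \<in> F))) powr (1 / p)) powr (p - 1) * extension_constant"
  have "0 \<le> ?C" by simp
  moreover have "ennreal \<bar>DtN p M \<nu> S E F G\<bar> \<le> ennreal ?C * hb_norm p \<theta> \<nu> G" if "G \<in> hb_space p \<theta> \<nu>" for G
    using DtN_bound[OF F that] by (simp add: ennreal_mult mult.assoc)
  ultimately show ?thesis using lin unfolding hb_dual_def by blast
qed

lemma DtN_norm_le: "DtN_norm p \<theta> M \<nu> S E \<le> ennreal (extension_constant powr p)"
  unfolding DtN_norm_def hb_dual_norm_def
proof (intro SUP_least)
  fix F G assume "F \<in> {F \<in> hb_space p \<theta> \<nu>. hb_norm p \<theta> \<nu> F = 1}"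
    and "G \<in> {G \<in> hb_space p \<theta> \<nu>. hb_norm p \<theta> \<nu> G \<le> 1}"
  then have F: "F \<in> hb_space p \<theta> \<nu>" "hb_norm p \<theta> \<nu> F = 1"
    and G: "G \<in> hb_space p \<theta> \<nu>" "hb_norm p \<theta> \<nu> G \<le> 1" by auto
  let ?f = "SOME f. f \<in> F"
  have "field_energy (grad S (E ?f)) powr (1 / p) \<le> extension_constant"
    using F hb_space_memD[OF F(1) hb_space_some_mem[OF F(1)]]
    by (intro extension_energy_unit) (auto simp: hb_norm_def)
  then have le: "(field_energy (grad S (E ?f)) powr (1 / p)) powr (p - 1) \<le> extension_constant powr (p - 1)"
    using exponent by (intro powr_mono2) auto
  have "ennreal \<bar>DtN p M \<nu> S E F G\<bar>
      \<le> ennreal ((field_energy (grad S (E ?f)) powr (1 / p)) powr (p - 1))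
        * (ennreal extension_constant * hb_norm p \<theta> \<nu> G)" by (rule DtN_bound[OF F(1) G(1)])
  also have "\<dots> \<le> ennreal (extension_constant powr (p - 1)) * (ennreal extension_constant * 1)"
    by (intro mult_mono ennreal_leI le G) auto
  also have "\<dots> = ennreal (extension_constant powr p)"
    using powr_mult_base[of extension_constant "p - 1"]
    by (simp add: mult.commute flip: ennreal_mult)
  finally show "ennreal \<bar>DtN p M \<nu> S E F G\<bar> \<le> ennreal (extension_constant powr p)" .
qed

end

section \<open>The Dirichlet-to-Neumann map of a uniform domain\<close>

text \<open>
  Codimensionality controls boundary balls of radius below twice the diameter, and a radius of three
  halves of it already covers the boundary. If the diameter is zero the condition is vacuous and \<open>\<nu>\<close>
  may be infinite, but then the boundary is one point.
\<close>

lemma codimensional_boundary_finite: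
  fixes \<mu> \<nu> :: "'a::metric_space measure"
  assumes bd: "bounded (space \<nu>)" and ne: "space \<nu> \<noteq> {}"
    and fin: "finite_measure \<mu>" and co: "codimensional \<Theta> \<mu> \<nu>"
  shows "finite_measure \<nu> \<or> (\<exists>\<xi>. space \<nu> = {\<xi>})"
proof (cases "diameter (space \<nu>) = 0")
  case True
  obtain \<xi> where xi: "\<xi> \<in> space \<nu>" using ne by auto
  have "y = \<xi>" if "y \<in> space \<nu>" for y
    using diameter_bounded_bound[OF bd that xi] True by simp
  then show ?thesis using xi by auto
next
  case False
  then have D: "0 < diameter (space \<nu>)" using diameter_ge_0[OF bd] by simp
  obtain \<xi> where xi: "\<xi> \<in> space \<nu>" using ne by auto
  define r where "r = 3 / 2 * diameter (space \<nu>)"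
  have r: "0 < r" "r < 2 * diameter (space \<nu>)" using D by (simp_all add: r_def)
  obtain C where "emeasure \<nu> (ball \<xi> r \<inter> space \<nu>)
      \<le> ennreal (C * r powr (- \<Theta>)) * emeasure \<mu> (ball \<xi> r \<inter> space \<mu>)"
    using co xi r unfolding codimensional_def by blast
  also have "\<dots> < \<infinity>"
    using finite_measure.emeasure_finite[OF fin] by (simp add: ennreal_mult_eq_top_iff less_top[symmetric])
  also have "ball \<xi> r \<inter> space \<nu> = space \<nu>"
    using diameter_bounded_bound[OF bd xi] D by (force simp: r_def)
  finally have "finite_measure \<nu>" by (intro finite_measureI) simp
  then show ?thesis ..
qed

theorem corollary4p3:
  fixes \<Omega> :: "'a::metric_space set"
    and \<mu> \<nu> :: "'a measure"
    and p \<Theta> \<theta> :: real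
    and S :: "('a, 'n::finite) cheeger"
    and E :: "('a \<Rightarrow> real) \<Rightarrow> 'a \<Rightarrow> real"
  assumes "1 < p"
    and "complete (closure \<Omega>)"
    and "bounded \<Omega>" and "locally compact \<Omega>" and "\<not> complete \<Omega>"
    and "uniform_domain \<Omega>"
    and "borel_regular \<Omega> \<mu>" and "positive_finite_on_balls \<mu>" and "doubling_measure \<mu>"
    and "poincare_inequality p \<mu>"
    and "0 < \<Theta>" and "\<Theta> < p" and "\<theta> = 1 - \<Theta> / p"
    and "borel_regular (closure \<Omega> - \<Omega>) \<nu>" and "codimensional \<Theta> \<mu> \<nu>"
    and "cheeger_structure p \<mu> S"
    and "extension_operator p \<theta> \<mu> \<nu> S E"
    and "\<forall>f\<in>besov_space p \<theta> \<nu>. \<exists>u. dirichlet_solution p \<mu> \<nu> S f u"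
  shows "(\<forall>F\<in>hb_space p \<theta> \<nu>.
            dirichlet_class p \<mu> \<nu> S F \<in> hn_space p \<mu> \<and>
            (\<forall>u\<in>dirichlet_class p \<mu> \<nu> S F. \<forall>G\<in>hb_space p \<theta> \<nu>. \<forall>g\<in>G.
               integrable \<mu> (flux_density p S u (E g)) \<and>
               DtN p \<mu> \<nu> S E F G = (LINT x|\<mu>. flux_density p S u (E g) x)) \<and>
            DtN p \<mu> \<nu> S E F \<in> hb_dual p \<theta> \<nu>) \<and>
         DtN_norm p \<theta> \<mu> \<nu> S E < \<infinity> \<and>
         DtN_norm p \<theta> \<mu> \<nu> S E \<le> enn_powr (extension_norm p \<theta> \<mu> \<nu> S E) p"
proof -
  have sp: "space \<mu> = \<Omega>" "space \<nu> = closure \<Omega> - \<Omega>"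
    and bs: "sets (restrict_space borel (space \<mu>)) \<subseteq> sets \<mu>"
      "sets (restrict_space borel (space \<nu>)) \<subseteq> sets \<nu>"
    using assms(7,14) by (auto simp: borel_regular_def)
  have bdry: "space \<nu> \<noteq> {}"
  proof
    assume "space \<nu> = {}"
    then have "closure \<Omega> = \<Omega>" using closure_subset[of \<Omega>] sp by auto
    then show False using assms by simp
  qed
  have "emeasure \<mu> (space \<mu>) < \<infinity>"
  proof -
    have "\<Omega> \<noteq> {}" using bdry sp by auto
    then obtain x where x: "x \<in> \<Omega>" by auto
    obtain e where e: "\<forall>y\<in>\<Omega>. dist x y \<le> e" using assms(3) bounded_any_center by blast
    have "ball x (\<bar>e\<bar> + 1) \<inter> space \<mu> = space \<mu>" using e sp by force
    then show ?thesis using assms(8) x sp unfolding positive_finite_on_balls_def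
      by (metis abs_ge_zero add_nonneg_pos zero_less_one)
  qed
  then have fin: "finite_measure \<mu>" by (intro finite_measureI) simp
  interpret M: borel_measure_space \<mu>
    using fin bs(1) by (simp add: borel_measure_space_def borel_measure_space_axioms_def)
  interpret C: cheeger_space \<mu> p S
    using assms sp by unfold_locales auto
  have bdry_bounded: "bounded (space \<nu>)" using assms(3) sp by (auto intro: bounded_subset[OF bounded_closure])
  \<comment> \<open>The dense set may lie in the domain rather than in the boundary, since distances to its points serve as well.\<close>
  obtain D where D: "countable D" "closure \<Omega> \<subseteq> closure D"
    using M.doubling_separable assms sp by auto
  have D\<nu>: "space \<nu> \<subseteq> closure D" using D sp by auto
  have besov: "(\<lambda>x. a * f x + b * g x) \<in> besov_space p \<theta> \<nu>"
      "besov_norm p \<theta> \<nu> (\<lambda>x. a * f x) = ennreal \<bar>a\<bar> * besov_norm p \<theta> \<nu> f"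
    if "f \<in> besov_space p \<theta> \<nu>" "g \<in> besov_space p \<theta> \<nu>" for f g a b
  proof -
    have m: "f \<in> borel_measurable \<nu>" "g \<in> borel_measurable \<nu>" using that by (auto simp: besov_space_def)
    from codimensional_boundary_finite[OF bdry_bounded bdry fin assms(15)]
    have "(\<lambda>x. a * f x + b * g x) \<in> besov_space p \<theta> \<nu> \<and>
      besov_norm p \<theta> \<nu> (\<lambda>x. a * f x) = ennreal \<bar>a\<bar> * besov_norm p \<theta> \<nu> f"
    proof
      assume "finite_measure \<nu>"
      then interpret N: borel_measure_space \<nu>
        using bs(2) by (simp add: borel_measure_space_def borel_measure_space_axioms_def)
      show ?thesis using C.exponent_pos
        by (intro conjI N.besov_space_lincomb[OF _ D(1) D\<nu>] N.besov_norm_scale[OF _ D(1) D\<nu>] that m)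
    next
      assume "\<exists>\<xi>. space \<nu> = {\<xi>}"
      then have "besov_norm p \<theta> \<nu> h = 0" for h using besov_norm_singleton by blast
      then show ?thesis using m by (simp add: besov_space_def)
    qed
    then show "(\<lambda>x. a * f x + b * g x) \<in> besov_space p \<theta> \<nu>"
      "besov_norm p \<theta> \<nu> (\<lambda>x. a * f x) = ennreal \<bar>a\<bar> * besov_norm p \<theta> \<nu> f" by auto
  qed
  interpret P: dirichlet_problem \<mu> p S \<nu> \<theta> E
    using besov assms by unfold_locales auto
  have "DtN_norm p \<theta> \<mu> \<nu> S E \<le> enn_powr (extension_norm p \<theta> \<mu> \<nu> S E) p"
    using P.DtN_norm_le by (subst P.extension_norm_eq) (simp add: enn_powr_ennreal)
  moreover have "DtN_norm p \<theta> \<mu> \<nu> S E < \<infinity>"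
    using P.DtN_norm_le by (rule order_le_less_trans) simp
  moreover have "integrable \<mu> (flux_density p S u (E g)) \<and>
      DtN p \<mu> \<nu> S E F G = (LINT x|\<mu>. flux_density p S u (E g) x)"
    if "F \<in> hb_space p \<theta> \<nu>" "u \<in> dirichlet_class p \<mu> \<nu> S F" "G \<in> hb_space p \<theta> \<nu>" "g \<in> G" for F u G g
  proof -
    have g: "g \<in> besov_space p \<theta> \<nu>" using hb_space_memD that by blast
    have "u \<in> newton_space p \<mu>" using that(2) P.solution_newton by (auto simp: dirichlet_class_def)
    then show ?thesis
      using P.integrable_flux P.DtN_eq[OF that] P.extension_newton[OF g] P.extension_trace[OF g] by blast
  qed
  ultimately show ?thesis using P.dirichlet_class_hn_space P.DtN_dual by blast
qed

end
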